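(* Let $(s_k)_{k\ge1}$ and $(t_k)_{k\ge1}$ be distinct sequences of positive integers such that $(s_k)$ lexicographically precedes $(t_k)$. Then there exists an integer $N$ such that $$\bigcup_{n\le N}\mathcal{C}^{(t_k)}_n\subsetneq\bigcup_{n\le N}\mathcal{C}^{(s_k)}_n.$$ In particular, the classes $\mathcal{C}^{(s_k)}$ and $\mathcal{C}^{(t_k)}$ have distinct enumeration sequences.
   Context: Permutations are in one-line notation; $\pi$ contains $\sigma$ if $\pi$ has a subsequence order-isomorphic to $\sigma$. A finite point set in the plane with distinct coordinates is order-isomorphic to a unique permutation. A factor of a word is a contiguous subword. Binary words: the complement of $\gamma_1\cdots\gamma_n$ is $(1-\gamma_1)\cdots(1-\gamma_n)$. For a sequence $(s_k)$ of positive integers set $\alpha^{(s_k)}_1=01$ and $\alpha^{(s_k)}_{i+1}=(\alpha^{(s_k)}_i)^{s_i}(\overline{\alpha}^{(s_k)}_i)^{s_i}$; $\mathcal{L}^{(s_k)}$ is the set of factors (including the empty word) of the words $\alpha^{(s_k)}_i$. Let $\rho$ be the morphism $0\mapsto\mathsf{d}\mathsf{r_d}$, $1\mapsto\mathsf{u}\mathsf{r_u}$ into words over $\{\mathsf{u},\mathsf{d},\mathsf{r_u},\mathsf{r_d}\}$, and $\mathcal{P}^{(s_k)}$ the set of factors of words $\rho(x)$, $x\in\mathcal{L}^{(s_k)}$. For such a word $w=w(1)\cdots w(n)$ define points $p_0,\dots,p_n$ with distinct coordinates: $p_0$ arbitrary; $p_1$ to the right of and above $p_0$ if $w(1)\in\{\mathsf{u},\mathsf{r_u}\}$,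 to the right of and below $p_0$ if $w(1)\in\{\mathsf{d},\mathsf{r_d}\}$; for $i\ge2$, $p_i$ lies outside the rectangular hull of $\{p_0,\dots,p_{i-1}\}$ and horizontally or vertically between $p_{i-1}$ and the rectangular hull of $\{p_0,\dots,p_{i-2}\}$, above that hull if $w(i)=\mathsf{u}$, below if $w(i)=\mathsf{d}$, to its right if $w(i)\in\{\mathsf{r_u},\mathsf{r_d}\}$. $\psi^\circ_w$ is the permutation order-isomorphic to $\{p_1,\dots,p_n\}$. $\mathcal{C}^{(s_k)}$ is the set of all permutations contained in $\psi^\circ_w$ for some $w\in\mathcal{P}^{(s_k)}$, and $\mathcal{C}^{(s_k)}_n$ is the set of its members of length $n$. The enumeration sequence of a class $\mathcal{C}$ is $(|\mathcal{C}_n|)_{n\ge0}$. *)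

theory Defs
  imports Complex_Main "HOL-Library.Sublist" "HOL-Library.Fun_Lexorder"
    "HOL-Combinatorics.Multiset_Permutations"
begin

section \<open>Permutations and containment\<close>

text \<open>A permutation of length \<open>n\<close>, in one-line notation, is a list enumerating \<open>{1..n}\<close>.\<close>

definition is_perm :: "nat list \<Rightarrow> bool" where
  "is_perm \<pi> \<longleftrightarrow> \<pi> \<in> permutations_of_set {1..length \<pi>}"

definition order_iso :: "'a::linorder list \<Rightarrow> 'b::linorder list \<Rightarrow> bool" where
  "order_iso xs ys \<longleftrightarrow> length xs = length ys \<and>
     (\<forall>i<length xs. \<forall>j<length xs. xs ! i < xs ! j \<longleftrightarrow> ys ! i < ys ! j)"

text \<open>Note that \<^const>\<open>subseq\<close> is the not necessarily contiguous subsequence relation,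
  whereas \<^const>\<open>sublist\<close>, used for factors of words below, is the contiguous one.\<close>

definition contains :: "nat list \<Rightarrow> nat list \<Rightarrow> bool" where
  "contains \<pi> \<sigma> \<longleftrightarrow> (\<exists>\<tau>. subseq \<tau> \<pi> \<and> order_iso \<tau> \<sigma>)"

text \<open>The point set is read from left to right, giving a sequence of heights.\<close>

definition points_order_iso :: "(real \<times> real) set \<Rightarrow> nat list \<Rightarrow> bool" where
  "points_order_iso S \<pi> \<longleftrightarrow>
     (\<exists>ps. set ps = S \<and> sorted_wrt (\<lambda>p q. fst p < fst q) ps \<and> order_iso (map snd ps) \<pi>)"


section \<open>The binary words\<close>

text \<open>The letters \<open>0\<close> and \<open>1\<close> are represented by \<^const>\<open>False\<close> and \<^const>\<open>True\<close>.
  Sequences are indexed from \<open>0\<close>: the value \<open>s i\<close> stands for \<open>s\<^sub>i\<^sub>+\<^sub>1\<close>, and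
  \<open>alpha s i\<close> for \<open>\<alpha>\<^sub>i\<^sub>+\<^sub>1\<close>.\<close>

definition complement :: "bool list \<Rightarrow> bool list" where
  "complement \<gamma> = map Not \<gamma>"

definition word_power :: "'a list \<Rightarrow> nat \<Rightarrow> 'a list" where
  "word_power x k = concat (replicate k x)"

primrec alpha :: "(nat \<Rightarrow> nat) \<Rightarrow> nat \<Rightarrow> bool list" where
  "alpha s 0 = [False, True]"
| "alpha s (Suc i) = word_power (alpha s i) (s i) @ word_power (complement (alpha s i)) (s i)"

definition binary_language :: "(nat \<Rightarrow> nat) \<Rightarrow> bool list set" where
  "binary_language s = {x. \<exists>i. sublist x (alpha s i)}"


section \<open>Pin words and pin sequences\<close>

datatype pin = Up | Down | RightU | RightD

definition rho :: "bool list \<Rightarrow> pin list" where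
  "rho x = concat (map (\<lambda>b. if b then [Up, RightU] else [Down, RightD]) x)"

definition pin_language :: "(nat \<Rightarrow> nat) \<Rightarrow> pin list set" where
  "pin_language s = {w. \<exists>x\<in>binary_language s. sublist w (rho x)}"

definition rect_hull :: "(real \<times> real) set \<Rightarrow> (real \<times> real) set" where
  "rect_hull S = {Min (fst ` S)..Max (fst ` S)} \<times> {Min (snd ` S)..Max (snd ` S)}"

definition above :: "real \<times> real \<Rightarrow> (real \<times> real) set \<Rightarrow> bool" where
  "above p H \<longleftrightarrow> (\<forall>q\<in>H. snd q < snd p)"

definition below :: "real \<times> real \<Rightarrow> (real \<times> real) set \<Rightarrow> bool" where
  "below p H \<longleftrightarrow> (\<forall>q\<in>H. snd p < snd q)"

definition right_of :: "real \<times> real \<Rightarrow> (real \<times> real) set \<Rightarrow> bool" where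
  "right_of p H \<longleftrightarrow> (\<forall>q\<in>H. fst q < fst p)"

definition horizontally_between ::
    "real \<times> real \<Rightarrow> real \<times> real \<Rightarrow> (real \<times> real) set \<Rightarrow> bool" where
  "horizontally_between p q H \<longleftrightarrow>
     (\<forall>r\<in>H. fst q < fst p \<and> fst p < fst r) \<or> (\<forall>r\<in>H. fst r < fst p \<and> fst p < fst q)"

definition vertically_between ::
    "real \<times> real \<Rightarrow> real \<times> real \<Rightarrow> (real \<times> real) set \<Rightarrow> bool" where
  "vertically_between p q H \<longleftrightarrow>
     (\<forall>r\<in>H. snd q < snd p \<and> snd p < snd r) \<or> (\<forall>r\<in>H. snd r < snd p \<and> snd p < snd q)"

text \<open>\<open>pin_sequence w p\<close> says that \<open>p 0, \<dots>, p n\<close>, where \<open>n = length w\<close>, are points as prescribed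
  by \<open>w\<close>; the letter \<open>w(i)\<close> is \<open>w ! (i - 1)\<close>. The direction of \<open>p i\<close> is taken relative to the hull
  of all preceding points \<open>p 0, \<dots>, p (i - 1)\<close>. For \<open>i \<ge> 3\<close> and the words considered here it could
  equally be taken relative to the hull of \<open>p 0, \<dots>, p (i - 2)\<close>, but for \<open>i = 2\<close>, when that hull is
  a single point, this would not determine the relative position of \<open>p 2\<close>.\<close>

definition pin_sequence :: "pin list \<Rightarrow> (nat \<Rightarrow> real \<times> real) \<Rightarrow> bool" where
  "pin_sequence w p \<longleftrightarrow>
     inj_on (\<lambda>i. fst (p i)) {..length w} \<and> inj_on (\<lambda>i. snd (p i)) {..length w} \<and>
     (1 \<le> length w \<longrightarrow>
        right_of (p 1) {p 0} \<and>
        (if w ! 0 \<in> {Up, RightU} then above (p 1) {p 0} else below (p 1) {p 0})) \<and>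
     (\<forall>i\<in>{2..length w}.
        let old = rect_hull (p ` {..i - 2}); new = rect_hull (p ` {..i - 1}) in
          p i \<notin> new \<and>
          (horizontally_between (p i) (p (i - 1)) old \<or> vertically_between (p i) (p (i - 1)) old) \<and>
          (case w ! (i - 1) of
             Up \<Rightarrow> above (p i) new
           | Down \<Rightarrow> below (p i) new
           | RightU \<Rightarrow> right_of (p i) new
           | RightD \<Rightarrow> right_of (p i) new))"

text \<open>The point \<open>p 0\<close> only serves to place the others and does not contribute to the permutation.\<close>

definition psi :: "pin list \<Rightarrow> nat list" where
  "psi w = (THE \<pi>. is_perm \<pi> \<and>
     (\<exists>p. pin_sequence w p \<and> points_order_iso (p ` {1..length w}) \<pi>))"


section \<open>The permutation classes\<close>

definition perm_class :: "(nat \<Rightarrow> nat) \<Rightarrow> nat list set" where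
  "perm_class s = {\<sigma>. is_perm \<sigma> \<and> (\<exists>w\<in>pin_language s. contains (psi w) \<sigma>)}"

definition of_length :: "nat list set \<Rightarrow> nat \<Rightarrow> nat list set" where
  "of_length C n = {\<sigma> \<in> C. length \<sigma> = n}"

definition enumeration :: "nat list set \<Rightarrow> nat \<Rightarrow> nat" where
  "enumeration C n = card (of_length C n)"

end

theory Submission
  imports Defs
begin

text \<open>Let \<open>k\<close> be the first index at which \<open>s\<close> and \<open>t\<close> differ and let \<open>x = alpha s k = alpha t k\<close>.
  Words of the two languages are concatenations of \<open>x\<close> and its complement, in which the
  lengths of the runs are \<open>s k\<close> or \<open>2 s k\<close> for \<open>s\<close>, and \<open>t k > s k\<close> or \<open>2 t k\<close> for \<open>t\<close>. With
  \<open>m = s k * length x + 2\<close>, all factors of length at most \<open>m\<close> for \<open>t\<close> are also factors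
  for \<open>s\<close>, whereas \<open>word_power x (s k)\<close> extended by the last letter of the complement of \<open>x\<close> on the left and by
  its first letter on the right is a factor \<open>y\<close> of length \<open>m\<close> for \<open>s\<close> only.

  The relative position of two points of a pin sequence depends only on the direction of the later one and on
  whether the two are adjacent in the sequence. So a permutation in a class splits into runs of
  consecutive pins, which can be placed independently because the language is closed
  under gluing. Permutations of length at most \<open>2 m\<close> only involve runs that meet at most \<open>m\<close> letters, up to
  an irrelevant first letter, and hence those for \<open>t\<close> also occur for \<open>s\<close>. Conversely the
  \<open>2 m - 2\<close> pins which read \<open>y\<close>, from the horizontal pin of its first letter to the vertical pin of its last,
  preceded by an interval of two points, give a permutation of length \<open>2 m\<close> in which \<open>y\<close> can be recovered by
  peeling off the pins one by one from the last to the first.\<close>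

section \<open>Binary words\<close>

lemma length_complement [simp]: "length (complement x) = length x"
  by (simp add: complement_def)

lemma complement_complement [simp]: "complement (complement x) = x"
  by (simp add: complement_def comp_def)

lemma complement_append [simp]: "complement (x @ y) = complement x @ complement y"
  by (simp add: complement_def)

lemma word_power_Suc: "word_power x (Suc n) = x @ word_power x n"
  by (simp add: word_power_def)

lemma word_power_0 [simp]: "word_power x 0 = []"
  by (simp add: word_power_def)

lemma word_power_add: "word_power x (m + n) = word_power x m @ word_power x n"
  by (simp add: word_power_def replicate_add)

lemma word_power_Suc': "word_power x (Suc n) = word_power x n @ x"
  using word_power_add[of x n 1] by (simp add: word_power_Suc)

lemma complement_word_power: "complement (word_power x n) = word_power (complement x) n"
  by (induction n) (auto simp: word_power_Suc, simp add: complement_def)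

lemma sublist_complement: "sublist x y \<Longrightarrow> sublist (complement x) (complement y)"
  unfolding complement_def by (rule map_mono_sublist)

lemma sublist_iff_nth:
  "sublist z w \<longleftrightarrow> (\<exists>j. j + length z \<le> length w \<and> (\<forall>r<length z. z ! r = w ! (j + r)))"
proof
  assume "sublist z w"
  then obtain u v where w: "w = u @ z @ v" by (auto simp: sublist_def)
  show "\<exists>j. j + length z \<le> length w \<and> (\<forall>r<length z. z ! r = w ! (j + r))"
    by (rule exI[of _ "length u"]) (simp add: w nth_append)
next
  assume "\<exists>j. j + length z \<le> length w \<and> (\<forall>r<length z. z ! r = w ! (j + r))"
  then obtain j where j: "j + length z \<le> length w" "\<And>r. r < length z \<Longrightarrow> z ! r = w ! (j + r)" by blast
  have "z = take (length z) (drop j w)"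
    by (rule nth_equalityI) (use j in auto)
  then have "w = take j w @ z @ drop (length z) (drop j w)"
    by (metis append_take_drop_id)
  then show "sublist z w" by (metis sublist_appendI)
qed

text \<open>A letter \<open>b\<close> of \<open>bs\<close> acts as a sign: on Booleans
  \<open>\<noteq>\<close> is addition modulo 2, so \<open>False\<close> contributes \<open>x\<close>
  and \<open>True\<close> its complement.\<close>

definition blocks :: "bool list \<Rightarrow> bool list \<Rightarrow> bool list" where
  "blocks x bs = concat (map (\<lambda>b. map (\<lambda>c. c \<noteq> b) x) bs)"

lemma blocks_Nil [simp]: "blocks x [] = []"
  and blocks_Cons: "blocks x (b # bs) = map (\<lambda>c. c \<noteq> b) x @ blocks x bs"
  and blocks_append [simp]: "blocks x (bs @ cs) = blocks x bs @ blocks x cs"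
  by (simp_all add: blocks_def)

lemma length_blocks [simp]: "length (blocks x bs) = length x * length bs"
  by (induction bs) (simp_all add: blocks_Cons)

lemma nth_blocks:
  "n < length x * length bs \<Longrightarrow>
     blocks x bs ! n = (x ! (n mod length x) \<noteq> bs ! (n div length x))"
proof (induction bs arbitrary: n)
  case (Cons b bs)
  have x: "x \<noteq> []" using Cons.prems by auto
  show ?case
  proof (cases "n < length x")
    case True
    then show ?thesis by (simp add: blocks_Cons nth_append)
  next
    case False
    then have "n - length x < length x * length bs" using Cons.prems by simp
    from Cons.IH[OF this] show ?thesis using False x
      by (simp add: blocks_Cons nth_append le_mod_geq le_div_geq)
  qed
qed simp

lemma complement_blocks: "complement (blocks x bs) = blocks x (complement bs)"
  by (induction bs) (auto simp: blocks_Cons complement_def)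

lemma blocks_singleton_False: "blocks x [False] = x"
  by (simp add: blocks_def)

lemma blocks_replicate:
  "blocks x (replicate n False) = word_power x n"
  "blocks x (replicate n True) = word_power (complement x) n"
proof -
  have *: "(\<lambda>c. c \<noteq> True) = Not" by (auto simp: fun_eq_iff)
  show "blocks x (replicate n False) = word_power x n"
    "blocks x (replicate n True) = word_power (complement x) n"
    by (simp_all add: blocks_def word_power_def complement_def map_replicate *)
qed

lemma word_power_blocks: "word_power (blocks x bs) n = blocks x (word_power bs n)"
  by (induction n) (simp_all add: word_power_Suc)

section \<open>Block structure of the words alpha\<close>

lemma alpha_Suc_blocks:
  "alpha s (Suc i) = blocks (alpha s i) (replicate (s i) False @ replicate (s i) True)"
  by (simp add: blocks_replicate)

lemma length_alpha_Suc: "length (alpha s (Suc i)) = length (alpha s i) * (2 * s i)"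
  by (subst alpha_Suc_blocks) (simp del: alpha.simps)

lemma nth_alpha_Suc:
  assumes "n < length (alpha s i) * (2 * s i)"
  shows "alpha s (Suc i) ! n =
    (alpha s i ! (n mod length (alpha s i)) \<noteq> (s i \<le> n div length (alpha s i)))"
proof -
  let ?q = "length (alpha s i)"
  have "n div ?q < 2 * s i" using assms by (simp add: less_mult_imp_div_less mult.commute)
  then show ?thesis using assms
    by (subst alpha_Suc_blocks)
      (simp del: alpha.simps blocks_append add: nth_blocks nth_append mult_2 not_less)
qed

text \<open>Powers and complements act on the signs alone, so the recursion for \<open>alpha\<close>
  preserves block words over \<open>alpha s k\<close>.\<close>

lemma alpha_blocks: "k \<le> i \<Longrightarrow> \<exists>bs. alpha s i = blocks (alpha s k) bs"
proof (induction i rule: dec_induct)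
  case base
  show ?case using blocks_singleton_False by metis
next
  case (step i)
  then obtain bs where "alpha s i = blocks (alpha s k) bs" by blast
  then have "alpha s (Suc i) =
      blocks (alpha s k) (word_power bs (s i) @ word_power (complement bs) (s i))"
    by (simp add: complement_blocks word_power_blocks)
  then show ?case by blast
qed

lemma length_alpha_ge_2: "\<forall>k. 0 < s k \<Longrightarrow> 2 \<le> length (alpha s i)"
proof (induction i)
  case (Suc i)
  have "1 \<le> s i" using Suc.prems by (simp add: Suc_leI)
  then have "2 * 1 \<le> length (alpha s i) * (2 * s i)"
    using Suc by (intro mult_le_mono) auto
  then show ?case by (simp only: length_alpha_Suc)
qed simp

lemma alpha_halves:
  assumes "\<forall>k. 0 < s k"
  shows "\<exists>u. u \<noteq> [] \<and> alpha s i = u @ complement u"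
proof (cases i)
  case 0
  then show ?thesis by (intro exI[of _ "[False]"]) (simp add: complement_def)
next
  case (Suc j)
  have "length (word_power (alpha s j) (s j)) > 0"
    using spec[OF assms, of j] length_alpha_ge_2[OF assms, of j]
    by (cases "s j") (auto simp: word_power_Suc)
  then show ?thesis unfolding Suc
    by (intro exI[of _ "word_power (alpha s j) (s j)"]) (simp add: complement_word_power)
qed

text \<open>Since \<open>alpha s i\<close> is a word followed by its complement, moving half a
  period along complements each letter. This later trades a bad starting position for a change of
  sign.\<close>

lemma nth_alpha_half_period:
  assumes "\<forall>k. 0 < s k"
  obtains g where "0 < g" "length (alpha s i) = 2 * g"
    "\<And>n. alpha s i ! ((n + g) mod (2 * g)) = (\<not> alpha s i ! (n mod (2 * g)))"
proof -
  obtain u where u: "u \<noteq> []" "alpha s i = u @ complement u" using alpha_halves[OF assms] by blast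
  define g where "g = length u"
  have g: "0 < g" using u g_def by simp
  have "alpha s i ! ((n + g) mod (2 * g)) = (\<not> alpha s i ! (n mod (2 * g)))" for n
  proof -
    define r where "r = n mod (2 * g)"
    have r: "r < 2 * g" using g r_def by simp
    have e: "(n + g) mod (2 * g) = (r + g) mod (2 * g)" by (simp add: r_def mod_simps)
    show ?thesis
    proof (cases "r < g")
      case True
      then have "(r + g) mod (2 * g) = r + g" by simp
      then show ?thesis using True unfolding e r_def[symmetric]
        by (simp add: u nth_append g_def complement_def)
    next
      case False
      then have "(r + g) mod (2 * g) = r - g" using r by (simp add: le_mod_geq)
      moreover have "r - g < g" using r False by linarith
      ultimately show ?thesis using False r unfolding e r_def[symmetric]
        by (simp add: u nth_append g_def complement_def)
    qed
  qed
  with that[of g] g show thesis using u by (simp add: g_def)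
qed

subsection \<open>The languages\<close>

lemma alpha_append_sublist:
  assumes "0 < s i"
  shows "sublist (alpha s i @ complement (alpha s i)) (alpha s (Suc i))"
proof -
  obtain j where j: "s i = Suc j" using assms by (cases "s i") auto
  have "alpha s (Suc i) = word_power (alpha s i) j @ (alpha s i @ complement (alpha s i)) @
          word_power (complement (alpha s i)) j"
    unfolding alpha.simps j by (subst word_power_Suc') (simp add: word_power_Suc)
  then show ?thesis by (metis sublist_appendI)
qed

lemma sublist_alpha_mono:
  assumes "\<forall>k. 0 < s k" "i \<le> j"
  shows "sublist (alpha s i) (alpha s j)"
  using assms(2)
proof (induction j rule: dec_induct)
  case (step j)
  have "sublist (alpha s j) (alpha s (Suc j))"
    using alpha_append_sublist[of s j] assms(1)
    by (meson sublist_append_rightI sublist_order.order.trans)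
  then show ?case using step sublist_order.order.trans by blast
qed simp

lemma complement_sublist_alpha:
  assumes "\<forall>k. 0 < s k" "i < j"
  shows "sublist (complement (alpha s i)) (alpha s j)"
proof -
  have "sublist (complement (alpha s i)) (alpha s (Suc i))"
    using alpha_append_sublist[of s i] assms(1)
    by (meson sublist_append_leftI sublist_order.order.trans)
  then show ?thesis using sublist_alpha_mono[OF assms(1), of "Suc i" j] assms(2)
    by (meson Suc_leI sublist_order.order.trans)
qed

lemma binary_language_sublist:
  "x \<in> binary_language s \<Longrightarrow> sublist y x \<Longrightarrow> y \<in> binary_language s"
  unfolding binary_language_def using sublist_order.order.trans by blast

lemma alpha_in_language: "alpha s i \<in> binary_language s"
  by (auto simp: binary_language_def)

lemma binary_language_complement:
  assumes "\<forall>k. 0 < s k" "x \<in> binary_language s"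
  shows "complement x \<in> binary_language s"
proof -
  obtain i where "sublist x (alpha s i)" using assms by (auto simp: binary_language_def)
  then have "sublist (complement x) (alpha s (Suc i))"
    using complement_sublist_alpha[OF assms(1), of i "Suc i"] sublist_complement
      sublist_order.order.trans by blast
  then show ?thesis by (rule binary_language_sublist[OF alpha_in_language])
qed

lemma append_sublist_append:
  assumes "sublist z\<^sub>1 v" "sublist z\<^sub>2 w"
  shows "\<exists>g. sublist (z\<^sub>1 @ g @ z\<^sub>2) (v @ w)"
proof -
  obtain a b c d where "v = a @ z\<^sub>1 @ b" "w = c @ z\<^sub>2 @ d" using assms by (auto simp: sublist_def)
  then have "v @ w = a @ (z\<^sub>1 @ (b @ c) @ z\<^sub>2) @ d" by simp
  then show ?thesis by (metis sublist_appendI)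
qed

text \<open>One word occurs in some \<open>alpha s k\<close>, the other in its complement, and the
  two together form a factor of the next level. Passing through the letter \<open>False\<close>
  makes the gap nonempty, which later keeps pins of the two words from being adjacent.\<close>

lemma binary_language_glue:
  assumes s: "\<forall>k. 0 < s k" and "z\<^sub>1 \<in> binary_language s" "z\<^sub>2 \<in> binary_language s"
  shows "\<exists>g. g \<noteq> [] \<and> z\<^sub>1 @ g @ z\<^sub>2 \<in> binary_language s"
proof -
  have *: "\<exists>g. x @ g @ y \<in> binary_language s"
    if "x \<in> binary_language s" "y \<in> binary_language s" for x y
  proof -
    obtain i j where ij: "sublist x (alpha s i)" "sublist y (alpha s j)"
      using \<open>x \<in> binary_language s\<close> \<open>y \<in> binary_language s\<close> by (auto simp: binary_language_def)
    define k where "k = Suc (max i j)"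
    have "sublist x (alpha s k)"
      using sublist_order.order.trans[OF ij(1) sublist_alpha_mono[OF s, of i k]] by (simp add: k_def)
    moreover have "sublist y (complement (alpha s k))"
    proof -
      have "sublist (complement (alpha s j)) (alpha s k)"
        by (rule complement_sublist_alpha[OF s]) (simp add: k_def)
      from sublist_order.order.trans[OF ij(2)] sublist_complement[OF this] show ?thesis by simp
    qed
    ultimately obtain g where "sublist (x @ g @ y) (alpha s k @ complement (alpha s k))"
      using append_sublist_append by blast
    then have "x @ g @ y \<in> binary_language s"
      using sublist_order.order.trans[OF _ alpha_append_sublist[of s k]] s
        binary_language_sublist[OF alpha_in_language[of s "Suc k"]] by blast
    then show ?thesis by blast
  qed
  have "[False] \<in> binary_language s"
    by (rule binary_language_sublist[OF alpha_in_language[of s 0]]) (simp add: sublist_code)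
  from *[OF assms(2) this] obtain g where "z\<^sub>1 @ g @ [False] \<in> binary_language s" by blast
  from *[OF this assms(3)] obtain g' where "(z\<^sub>1 @ g @ [False]) @ g' @ z\<^sub>2 \<in> binary_language s" by blast
  then have "z\<^sub>1 @ (g @ [False] @ g') @ z\<^sub>2 \<in> binary_language s" by simp
  then show ?thesis by blast
qed

lemma binary_language_left_extend:
  assumes "\<forall>k. 0 < s k" "z \<in> binary_language s"
  shows "\<exists>b. b # z \<in> binary_language s"
proof -
  obtain g where g: "g \<noteq> []" "z @ g @ z \<in> binary_language s"
    using binary_language_glue[OF assms assms(2)] by blast
  have "z @ g @ z = (z @ butlast g) @ (last g # z) @ []" using g(1) by simp
  then have "sublist (last g # z) (z @ g @ z)" by (metis sublist_appendI)
  then show ?thesis using binary_language_sublist g(2) by blast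
qed

subsection \<open>Synchronisation\<close>

lemma div_add_offset:
  fixes q c j r :: nat
  assumes "j < q" "r < q"
  shows "(c * q + j + r) div q = (if q \<le> j + r then Suc c else c)"
proof (cases "q \<le> j + r")
  case True
  have "(c * q + j + r) div q = (Suc c * q + (j + r - q)) div q"
    using True by (simp add: add.assoc)
  also have "\<dots> = Suc c" using assms True by (subst div_mult_self3) auto
  finally show ?thesis using True by simp
next
  case False
  have "(c * q + (j + r)) div q = c" using assms False by (subst div_mult_self3) auto
  then show ?thesis using False by (simp add: add.assoc)
qed

text \<open>A misaligned copy of \<open>x @ complement x\<close> would meet three consecutive
  blocks. Each half crosses a block boundary, and by \<open>no_interior\<close> the signs on both
  sides of it agree. With all three signs equal, the two halves would read the same letters,
  although they are complementary.\<close>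

lemma blocks_synchronise:
  fixes x :: "bool list" and f :: "nat \<Rightarrow> bool"
  defines "q \<equiv> length x"
  assumes no_interior: "\<And>j h. 0 < j \<Longrightarrow> j < q \<Longrightarrow>
      \<not> (\<forall>r<q. x ! r = (x ! ((j + r) mod q) \<noteq> (h \<noteq> (q \<le> j + r))))"
    and "0 < q"
    and occ: "\<And>r. r < 2 * q \<Longrightarrow>
      (x ! (r mod q) \<noteq> (q \<le> r)) = (x ! ((i + r) mod q) \<noteq> f ((i + r) div q))"
  shows "q dvd i"
proof (rule ccontr)
  assume "\<not> q dvd i"
  define c j where "c = i div q" and "j = i mod q"
  have i: "i = c * q + j" by (simp add: c_def j_def)
  have j: "0 < j" "j < q"
    using \<open>\<not> q dvd i\<close> \<open>0 < q\<close> by (simp_all add: j_def mod_greater_zero_iff_not_dvd)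
  have m: "(i + r) mod q = (j + r) mod q" for r by (simp add: j_def mod_simps)
  have first: "x ! r = (x ! ((j + r) mod q) \<noteq> f (if q \<le> j + r then Suc c else c))"
    if "r < q" for r
    using occ[of r] that div_add_offset[OF j(2) that, of c] by (simp add: m) (simp add: i)
  have second: "(\<not> x ! r) =
      (x ! ((j + r) mod q) \<noteq> f (if q \<le> j + r then Suc (Suc c) else Suc c))" if "r < q" for r
  proof -
    have "(i + (r + q)) div q = (Suc c * q + j + r) div q" by (simp add: i algebra_simps)
    also note div_add_offset[OF j(2) that, of "Suc c"]
    finally have "(i + (r + q)) div q = (if q \<le> j + r then Suc (Suc c) else Suc c)" .
    moreover have "(i + (r + q)) mod q = (j + r) mod q"
      using m[of "r + q"] by (metis add.assoc mod_add_self2)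
    ultimately show ?thesis using occ[of "r + q"] that by simp
  qed
  have c01: "f (Suc c) = f c"
  proof (rule ccontr)
    assume ne: "f (Suc c) \<noteq> f c"
    have "\<forall>r<q. x ! r = (x ! ((j + r) mod q) \<noteq> (f c \<noteq> (q \<le> j + r)))"
    proof (intro allI impI)
      fix r assume "r < q"
      from first[OF this] show "x ! r = (x ! ((j + r) mod q) \<noteq> (f c \<noteq> (q \<le> j + r)))"
        using ne by (cases "q \<le> j + r") simp_all
    qed
    then show False using no_interior[OF j] by blast
  qed
  have c12: "f (Suc (Suc c)) = f (Suc c)"
  proof (rule ccontr)
    assume ne: "f (Suc (Suc c)) \<noteq> f (Suc c)"
    have "\<forall>r<q. x ! r = (x ! ((j + r) mod q) \<noteq> ((\<not> f (Suc c)) \<noteq> (q \<le> j + r)))"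
    proof (intro allI impI)
      fix r assume "r < q"
      from second[OF this]
      show "x ! r = (x ! ((j + r) mod q) \<noteq> ((\<not> f (Suc c)) \<noteq> (q \<le> j + r)))"
        using ne by (cases "q \<le> j + r") auto
    qed
    then show False using no_interior[OF j] by blast
  qed
  show False using first[OF \<open>0 < q\<close>] second[OF \<open>0 < q\<close>] c01 c12 by (auto split: if_splits)
qed

text \<open>The word \<open>x = alpha s k\<close> does not occur in \<open>x @ complement x\<close> or in \<open>complement x @ x\<close>
  except as one of the two halves. For \<open>k > 0\<close> this follows from the synchronisation property of
  \<open>alpha s (k - 1)\<close>, since \<open>x\<close> contains \<open>alpha s (k - 1) @ complement (alpha s (k - 1))\<close>.\<close>

lemma alpha_no_interior:
  assumes s: "\<forall>k. 0 < s k" and "0 < j" "j < length (alpha s k)"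
  shows "\<not> (\<forall>r<length (alpha s k). alpha s k ! r =
    (alpha s k ! ((j + r) mod length (alpha s k)) \<noteq> (h \<noteq> (length (alpha s k) \<le> j + r))))"
  using assms(2,3)
proof (induction k arbitrary: j h)
  case 0
  then have "j = 1" by simp
  then show ?case by (auto simp: numeral_2_eq_2 All_less_Suc)
next
  case (Suc k)
  define x q e p where "x = alpha s k" and "q = length x" and "e = s k" and "p = q * (2 * e)"
  have p: "length (alpha s (Suc k)) = p" by (simp only: length_alpha_Suc p_def q_def x_def e_def)
  have q: "0 < q" using length_alpha_ge_2[OF s, of k] unfolding q_def x_def by linarith
  have e: "0 < e" using s by (simp add: e_def)
  have x': "alpha s (Suc k) ! n = (x ! (n mod q) \<noteq> (e \<le> n div q))" if "n < p" for n
    using nth_alpha_Suc[of n s k] that by (simp only: p_def q_def x_def e_def)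
  show ?case unfolding p
  proof
    assume H: "\<forall>r<p. alpha s (Suc k) ! r =
        (alpha s (Suc k) ! ((j + r) mod p) \<noteq> (h \<noteq> (p \<le> j + r)))"
    have j: "0 < j" "j < p" using Suc.prems p by auto
    \<comment> \<open>\<open>f i\<close> is the sign of block \<open>i\<close> in
      \<open>alpha s (Suc k)\<close> followed by its complement, the whole being complemented if
      \<open>h\<close> holds.\<close>
    define f where "f i = ((e \<le> i mod (2 * e)) \<noteq> (h \<noteq> (2 * e \<le> i)))" for i
    have p0: "0 < p" using q e by (simp add: p_def)
    have H': "(x ! (r mod q) \<noteq> (e \<le> r div q)) = (x ! ((j + r) mod q) \<noteq> f ((j + r) div q))"
      if "r < p" for r
    proof -
      have 1: "(j + r) mod p mod q = (j + r) mod q" by (simp add: p_def mod_mult2_eq)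
      have 2: "(j + r) mod p div q = (j + r) div q mod (2 * e)"
        using q by (simp add: p_def mod_mult2_eq)
      have 3: "p \<le> j + r \<longleftrightarrow> 2 * e \<le> (j + r) div q"
        using q by (simp add: p_def less_eq_div_iff_mult_less_eq mult.commute)
      show ?thesis using H[rule_format, OF that] x'[OF that] x'[of "(j + r) mod p"] p0
        unfolding f_def by (simp add: 1 2 3) blast
    qed
    \<comment> \<open>The centre of \<open>alpha s (Suc k)\<close>, starting at
      \<open>(e - 1) * q\<close>, reads \<open>x @ complement x\<close>, to which
      \<open>blocks_synchronise\<close> applies.\<close>
    have sync: "(x ! (r mod q) \<noteq> (q \<le> r)) =
        (x ! ((j + (e - 1) * q + r) mod q) \<noteq> f ((j + (e - 1) * q + r) div q))" if "r < 2 * q" for r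
    proof -
      have "(e - 1) * q + r < (e - 1) * q + 2 * q" using that by simp
      also have "\<dots> = (e + 1) * q" using e by (cases e) (simp_all add: algebra_simps)
      also have "\<dots> \<le> 2 * e * q" using e by (intro mult_le_mono1) simp
      finally have "(e - 1) * q + r < p" by (simp add: p_def algebra_simps)
      from H'[OF this] have "(x ! (((e - 1) * q + r) mod q) \<noteq> (e \<le> ((e - 1) * q + r) div q)) =
          (x ! ((j + (e - 1) * q + r) mod q) \<noteq> f ((j + (e - 1) * q + r) div q))"
        by (simp only: add.assoc)
      moreover have "((e - 1) * q + r) mod q = r mod q" by simp
      moreover have "e \<le> ((e - 1) * q + r) div q \<longleftrightarrow> q \<le> r"
      proof -
        have "((e - 1) * q + r) div q = e - 1 + r div q" using q by simp
        moreover have "q \<le> r \<longleftrightarrow> 1 \<le> r div q"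
          using q by (simp add: less_eq_div_iff_mult_less_eq)
        ultimately show ?thesis using e by auto
      qed
      ultimately show ?thesis by simp
    qed
    have "length x dvd j + (e - 1) * q"
    proof (rule blocks_synchronise[where f = f])
      show "\<not> (\<forall>r<length x. x ! r =
          (x ! ((j + r) mod length x) \<noteq> (h \<noteq> (length x \<le> j + r))))"
        if "0 < j" "j < length x" for j h
        using Suc.IH that unfolding x_def by blast
    qed (use q sync in \<open>simp_all add: q_def\<close>)
    then have "q dvd j" unfolding q_def[symmetric] by (simp add: dvd_add_left_iff)
    then obtain l where l: "j = l * q" by (metis dvdE mult.commute)
    have l2: "0 < l" "l < 2 * e" using j q by (simp_all add: l p_def mult.commute)
    \<comment> \<open>The four sign runs of length \<open>e\<close> are \<open>h\<close>,
      \<open>\<not> h\<close>, \<open>\<not> h\<close>, \<open>h\<close>. The aligned centre sits on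
      blocks \<open>l + e - 1\<close> and \<open>l + e\<close>, both in the two middle runs, yet it
      needs two different signs.\<close>
    have f_const: "f i = (\<not> h)" if "e \<le> i" "i < 3 * e" for i
    proof (cases "i < 2 * e")
      case False
      then have "i mod (2 * e) = i - 2 * e" "\<not> e \<le> i - 2 * e"
        using that by (simp_all add: le_mod_geq)
      then show ?thesis using that False by (simp add: f_def)
    qed (use that in \<open>simp add: f_def\<close>)
    have b0: "j + (e - 1) * q = (l + e - 1) * q"
      using e by (cases e) (simp_all add: l algebra_simps)
    have b1: "j + (e - 1) * q + q = (l + e) * q"
      using e by (cases e) (simp_all add: l algebra_simps)
    have "\<not> f (l + e - 1)" using sync[of 0] q unfolding add_0_right b0 by auto
    moreover have "f (l + e)" using sync[of q] q unfolding b1 by auto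
    moreover have "e \<le> l + e - 1" "l + e - 1 < 3 * e" "e \<le> l + e" "l + e < 3 * e"
      using l2 by linarith+
    ultimately show False using f_const by blast
  qed
qed

subsection \<open>Comparison of two languages\<close>

lemma le_mod_double_iff:
  fixes b n :: nat
  assumes "0 < b"
  shows "b \<le> n mod (b * 2) \<longleftrightarrow> odd (n div b)"
  using assms by (cases "even (n div b)") (auto simp: mod_mult2_eq odd_iff_mod_2_eq_one not_le)

text \<open>Words at levels above \<open>k\<close> consist of copies of
  \<open>alpha t (Suc k)\<close> and its complement, whose halves are powers of
  \<open>alpha t k\<close> or of its complement. So the sign \<open>H\<close> can change only at
  multiples of the length of a half.\<close>

lemma binary_language_nth:
  assumes t: "\<forall>k. 0 < t k" and z: "z \<in> binary_language t"
  shows "\<exists>j H. \<forall>r<length z. z ! r =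
    (alpha t k ! ((j + r) mod length (alpha t k)) \<noteq> H ((j + r) div (length (alpha t k) * t k)))"
proof -
  define x q b p where "x = alpha t k" and "q = length x" and "b = t k" and "p = q * (b * 2)"
  have q: "0 < q" using length_alpha_ge_2[OF t, of k] unfolding q_def x_def by linarith
  have b: "0 < b" using t by (simp add: b_def)
  have p: "length (alpha t (Suc k)) = p"
    by (simp only: length_alpha_Suc p_def q_def x_def b_def mult.commute)
  obtain i where i: "sublist z (alpha t i)" using z by (auto simp: binary_language_def)
  define i' where "i' = max i (Suc k)"
  have "sublist z (alpha t i')"
    using i sublist_alpha_mono[OF t, of i i'] sublist_order.order.trans by (simp add: i'_def)
  then obtain j where j: "j + length z \<le> length (alpha t i')"
    "\<And>r. r < length z \<Longrightarrow> z ! r = alpha t i' ! (j + r)"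
    unfolding sublist_iff_nth by blast
  obtain bs where bs: "alpha t i' = blocks (alpha t (Suc k)) bs"
    using alpha_blocks[of "Suc k" i' t] by (auto simp: i'_def)
  \<comment> \<open>The index counts halves: \<open>i div 2\<close> is the enclosing copy of
    \<open>alpha t (Suc k)\<close>, and odd \<open>i\<close> are its complemented second
    halves.\<close>
  define H where "H i = (odd i \<noteq> bs ! (i div 2))" for i
  have "alpha t i' ! n = (x ! (n mod q) \<noteq> H (n div (q * b)))" if "n < length (alpha t i')" for n
  proof -
    have "0 < p" using q b by (simp add: p_def)
    have n: "n < p * length bs" using that by (simp only: bs length_blocks p)
    then have "alpha t i' ! n = (alpha t (Suc k) ! (n mod p) \<noteq> bs ! (n div p))"
      unfolding bs by (subst nth_blocks) (simp_all only: p)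
    also have "alpha t (Suc k) ! (n mod p) = (x ! (n mod p mod q) \<noteq> (b \<le> n mod p div q))"
      using nth_alpha_Suc[of "n mod p" t k] \<open>0 < p\<close>
      by (simp only: p_def q_def x_def b_def mult.commute mod_less_divisor)
    also have "n mod p mod q = n mod q" by (simp add: p_def mod_mult2_eq)
    also have "n mod p div q = n div q mod (b * 2)"
      using q by (simp add: p_def mod_mult2_eq)
    also have "(b \<le> n div q mod (b * 2)) = odd (n div (q * b))"
      by (simp only: le_mod_double_iff[OF b] div_mult2_eq)
    also have "n div p = n div (q * b) div 2" by (simp only: p_def div_mult2_eq mult.assoc)
    finally show ?thesis unfolding H_def by blast
  qed
  then have "\<forall>r<length z. z ! r = (x ! ((j + r) mod q) \<noteq> H ((j + r) div (q * b)))"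
    using j by simp
  then show ?thesis unfolding x_def q_def b_def by blast
qed

text \<open>A window of length at most \<open>M\<close> has at most one block boundary strictly
  inside; in the case \<open>cross\<close> it lies \<open>i\<close> letters into the window.\<close>

lemma block_boundary_cases:
  fixes j l M :: nat
  assumes "l \<le> M" "0 < M"
  obtains (inside) c where "\<And>r. r < l \<Longrightarrow> (j + r) div M = c"
  | (cross) c i where "0 < i" "i < l" "M dvd j + i"
      "\<And>r. r < l \<Longrightarrow> (j + r) div M = (if i \<le> r then Suc c else c)"
proof -
  define c d where "c = j div M" and "d = j mod M"
  have j: "j = c * M + d" by (simp add: c_def d_def)
  have d: "d < M" using assms by (simp add: d_def)
  have *: "(j + r) div M = (if M \<le> d + r then Suc c else c)" if "r < l" for r
    using div_add_offset[OF d, of r c] that assms by (simp add: j)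
  show thesis
  proof (cases "d + l \<le> M")
    case True
    then show thesis using * by (intro inside[of c]) auto
  next
    case False
    have i: "0 < M - d" "M - d < l" using d False by auto
    have "M dvd j + (M - d)" using d by (simp add: j)
    moreover have "(j + r) div M = (if M - d \<le> r then Suc c else c)" if "r < l" for r
      using *[OF that] by auto
    ultimately show thesis using cross[OF i] by blast
  qed
qed

lemma word_power_commute: "word_power x n @ x = x @ word_power x n"
  by (metis word_power_Suc word_power_Suc')

text \<open>The factor of \<open>complement x @ word_power x (s k) @ complement x\<close>, with \<open>x = alpha s k\<close>, that extends
  the power by one letter on either side. The letters at its ends break the period \<open>length x\<close>, which is
  why it is not in the language of a sequence that lexicographically follows \<open>s\<close> and branches off at \<open>k\<close>.\<close>

definition marker :: "(nat \<Rightarrow> nat) \<Rightarrow> nat \<Rightarrow> nat \<Rightarrow> bool list" where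
  "marker s k a = (\<not> last (alpha s k)) # word_power (alpha s k) a @ [\<not> hd (alpha s k)]"

lemma length_word_power [simp]: "length (word_power x n) = n * length x"
  by (induction n) (simp_all add: word_power_Suc)

lemma length_marker: "length (marker s k a) = a * length (alpha s k) + 2"
  by (simp add: marker_def)

lemma nth_word_power:
  fixes x :: "bool list"
  assumes "n < a * length x"
  shows "word_power x a ! n = x ! (n mod length x)"
proof -
  have "n div length x < a" using assms by (simp add: less_mult_imp_div_less)
  then show ?thesis
    using nth_blocks[of n x "replicate a False"] assms by (simp add: blocks_replicate mult.commute)
qed

text \<open>The square of \<open>complement y\<close> contains \<open>complement x\<close>, then
  \<open>x\<close> to the power \<open>s k\<close>, then \<open>complement x\<close>. The square is
  sought in \<open>z @ complement z\<close> because \<open>z\<close> is just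
  \<open>y @ complement y\<close> when \<open>s (Suc k) = 1\<close>.\<close>

lemma marker_in_language:
  assumes s: "\<forall>k. 0 < s k"
  shows "marker s k (s k) \<in> binary_language s"
proof -
  define x y z where "x = alpha s k" and "y = alpha s (Suc k)" and "z = alpha s (Suc (Suc k))"
  have ne: "x \<noteq> []" using length_alpha_ge_2[OF s, of k] by (auto simp: x_def)
  obtain e where e: "s k = Suc e" using s by (metis gr0_implies_Suc)
  obtain f where f: "s (Suc k) = Suc f" using s by (metis gr0_implies_Suc)
  have z: "z = word_power y (Suc f) @ word_power (complement y) (Suc f)"
    by (simp add: z_def y_def f del: alpha.simps(2)) (simp add: f)
  have "sublist (complement y @ complement y) (z @ complement z)"
  proof -
    have "z @ complement z = (word_power y (Suc f) @ word_power (complement y) f) @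
        (complement y @ complement y) @ (word_power (complement y) f @ word_power y (Suc f))"
      unfolding z by (simp only: word_power_Suc' complement_append complement_word_power
          complement_complement append.assoc) (simp add: word_power_Suc word_power_commute)
    then show ?thesis by (metis sublist_appendI)
  qed
  moreover have "sublist (z @ complement z) (alpha s (Suc (Suc (Suc k))))"
    unfolding z_def using alpha_append_sublist s by blast
  moreover have "sublist (marker s k (s k)) (complement y @ complement y)"
  proof -
    have x: "x = butlast x @ [last x]" "x = hd x # tl x" using ne by simp_all
    have cx: "complement x = complement (butlast x) @ [\<not> last x]"
      "complement x = (\<not> hd x) # complement (tl x)"
      by (subst x(1), simp add: complement_def) (subst x(2), simp add: complement_def)
    have y: "complement y = word_power (complement x) (s k) @ word_power x (s k)"
      by (simp add: y_def x_def complement_word_power)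
    have "complement y @ complement y =
        (word_power (complement x) e @ complement x) @ word_power x (s k) @
        (complement x @ word_power (complement x) e) @ word_power x (s k)"
      unfolding y by (simp add: e word_power_Suc flip: word_power_Suc')
    also have "\<dots> = (word_power (complement x) e @ complement (butlast x)) @ marker s k (s k) @
        (complement (tl x) @ word_power (complement x) e @ word_power x (s k))"
      unfolding marker_def x_def[symmetric]
      by (subst cx(1), subst (2) cx(2)) simp
    finally show ?thesis by (metis sublist_appendI)
  qed
  ultimately show ?thesis
    by (meson alpha_in_language binary_language_sublist)
qed

text \<open>Each end letter breaks the period, so the sign must change within the first period and
  within the last one. The marker is short enough to meet only one possible place of change, which
  forces \<open>a = 1\<close> and puts the copy of \<open>x\<close> across a boundary, against
  \<open>alpha_no_interior\<close>.\<close>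

lemma marker_notin_language:
  assumes t: "\<forall>k. 0 < t k" and a: "0 < a" "a < t k"
  shows "marker t k a \<notin> binary_language t"
proof
  assume "marker t k a \<in> binary_language t"
  define x q b m y where "x = alpha t k" and "q = length x" and "b = t k" and "m = a * q + 2"
    and "y = marker t k a"
  have q: "2 \<le> q" using length_alpha_ge_2[OF t, of k] unfolding q_def x_def .
  have ne: "x \<noteq> []" using q by (auto simp: q_def)
  have y0: "y ! 0 = (\<not> x ! (q - 1))"
    using ne by (simp add: y_def marker_def x_def[symmetric] last_conv_nth q_def)
  have y_mid: "y ! Suc r = x ! (r mod q)" if "r < a * q" for r
    using that nth_word_power[of r a x] by (simp add: y_def marker_def x_def[symmetric] nth_append q_def)
  have y_last: "y ! Suc (a * q) = (\<not> x ! 0)"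
    using ne by (simp add: y_def marker_def x_def[symmetric] nth_append hd_conv_nth q_def)
  have "a * q + 2 \<le> Suc a * q" using q by simp
  also have "\<dots> \<le> q * b" using a unfolding b_def by (subst mult.commute) (intro mult_le_mono2, simp)
  finally have m: "m \<le> q * b" by (simp add: m_def)
  have aq: "q \<le> a * q" using a by simp
  obtain j H where H: "\<And>r. r < m \<Longrightarrow> y ! r = (x ! ((j + r) mod q) \<noteq> H ((j + r) div (q * b)))"
    using binary_language_nth[OF t \<open>marker t k a \<in> binary_language t\<close>, of k]
    unfolding length_marker y_def x_def q_def m_def b_def by blast
  \<comment> \<open>Letters \<open>0\<close> and \<open>q\<close> of the marker are read at the same
    position of \<open>x\<close> but differ, so their signs differ; likewise for the last letter and
    the one a period before it.\<close>
  have "y ! q = x ! (q - 1)" using y_mid[of "q - 1", OF less_le_trans[OF _ aq]] q by simp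
  then have left: "H (j div (q * b)) \<noteq> H ((j + q) div (q * b))"
    using H[of 0] H[of q] y0 q aq by (auto simp: m_def)
  have "y ! Suc (a * q - q) = x ! 0"
  proof -
    have "(a * q - q) mod q = 0" by (metis diff_mult_distrib mod_mult_self2_is_0 mult_1)
    moreover have "a * q - q < a * q" using aq q by linarith
    ultimately show ?thesis using y_mid[of "a * q - q"] by simp
  qed
  moreover have "(j + Suc (a * q - q)) mod q = (j + Suc (a * q)) mod q"
  proof -
    have "j + Suc (a * q) = j + Suc (a * q - q) + q" using aq by linarith
    then show ?thesis by (metis mod_add_self2)
  qed
  ultimately have right: "H ((j + Suc (a * q - q)) div (q * b)) \<noteq> H ((j + Suc (a * q)) div (q * b))"
    using H[of "Suc (a * q - q)"] H[of "Suc (a * q)"] y_last q aq by (auto simp: m_def)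
  have "0 < q * b" using m unfolding m_def by linarith
  show False
    using m \<open>0 < q * b\<close>
  proof (cases rule: block_boundary_cases[of m "q * b" j])
    case (inside c)
    then show False using left inside[of 0] inside[of q] aq by (simp add: m_def)
  next
    case (cross c i)
    have "i \<le> q" using left cross(4)[of 0] cross(4)[of q] aq by (auto simp: m_def split: if_splits)
    moreover have "Suc (a * q - q) < i"
      using right cross(4)[of "Suc (a * q - q)"] cross(4)[of "Suc (a * q)"] aq q
      by (auto simp: m_def split: if_splits)
    ultimately have "a * q < 2 * q" by linarith
    then have "a = 1" using a q by simp
    have i: "1 < i" "i \<le> q" using \<open>i \<le> q\<close> \<open>Suc (a * q - q) < i\<close> by simp_all
    have Hne: "H (Suc c) \<noteq> H c"
      using left cross(4)[of 0] cross(4)[of q] aq i by (auto simp: m_def split: if_splits)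
    \<comment> \<open>The copy of \<open>x\<close> starts at letter 1 of the marker and the boundary
      is at letter \<open>i\<close>, so the copy starts \<open>q - (i - 1)\<close> letters into its
      block.\<close>
    define j' where "j' = q + 1 - i"
    have j': "0 < j'" "j' < q" using i by (auto simp: j'_def)
    have "q dvd j + i" using cross(3) by (metis dvd_mult_left)
    then obtain l where l: "j + i = l * q" by (metis dvdE mult.commute)
    have shift: "(j + Suc r) mod q = (j' + r) mod q" for r
    proof -
      have "j + Suc r + q = j' + r + l * q" using l i unfolding j'_def by linarith
      then show ?thesis by (metis mod_add_self2 mod_mult_self1)
    qed
    have "\<forall>r<q. x ! r = (x ! ((j' + r) mod q) \<noteq> (H c \<noteq> (q \<le> j' + r)))"
    proof (intro allI impI)
      fix r assume r: "r < q"
      have "q \<le> j' + r \<longleftrightarrow> i \<le> Suc r" using i by (auto simp: j'_def)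
      moreover have "Suc r < m" using r \<open>a = 1\<close> by (simp add: m_def)
      ultimately show "x ! r = (x ! ((j' + r) mod q) \<noteq> (H c \<noteq> (q \<le> j' + r)))"
        using H[of "Suc r"] cross(4)[of "Suc r"] y_mid[of r] r \<open>a = 1\<close> Hne shift[of r]
        by (cases "i \<le> Suc r") auto
    qed
    then show False using alpha_no_interior[OF t j'(1), of k "H c"] j'(2)
      unfolding x_def q_def by blast
  qed
qed

section \<open>Short factors shared by the two languages\<close>

lemma in_language_if_nth_blocks:
  assumes "blocks x bs \<in> binary_language s" "i + length z \<le> length x * length bs"
    and "\<And>r. r < length z \<Longrightarrow> z ! r = (x ! ((i + r) mod length x) \<noteq> bs ! ((i + r) div length x))"
  shows "z \<in> binary_language s"
proof -
  have "\<forall>r<length z. z ! r = blocks x bs ! (i + r)"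
    using assms(2,3) nth_blocks[of _ x bs] by auto
  then have "sublist z (blocks x bs)" using assms(2) unfolding sublist_iff_nth by auto
  then show ?thesis using assms(1) binary_language_sublist by blast
qed

text \<open>\<open>alpha s (Suc k)\<close> followed by its complement has sign runs of lengths
  \<open>s k\<close>, \<open>2 * s k\<close> and \<open>s k\<close>; both words are read off it or
  its complement.\<close>

lemma blocks_in_language:
  assumes s: "\<forall>k. 0 < s k"
  shows "blocks (alpha s k) (replicate (s k) h @ replicate (2 * s k) (\<not> h)) \<in> binary_language s"
    and "blocks (alpha s k) (replicate (2 * s k) h @ replicate (s k) (\<not> h)) \<in> binary_language s"
proof -
  let ?x = "alpha s k" and ?a = "s k"
  let ?w = "\<lambda>h. replicate ?a h @ replicate (2 * ?a) (\<not> h) @ replicate ?a h"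
  have "sublist (alpha s (Suc k) @ complement (alpha s (Suc k))) (alpha s (Suc (Suc k)))"
    using alpha_append_sublist s by blast
  moreover have "alpha s (Suc k) @ complement (alpha s (Suc k)) = blocks ?x (?w False)"
    by (simp only: alpha_Suc_blocks complement_blocks flip: blocks_append)
      (simp add: complement_def mult_2 replicate_add)
  ultimately have F: "blocks ?x (?w False) \<in> binary_language s"
    using alpha_in_language binary_language_sublist by metis
  have "blocks ?x (?w True) = complement (blocks ?x (?w False))"
    by (simp only: complement_blocks) (simp add: complement_def)
  then have "blocks ?x (?w True) \<in> binary_language s" using binary_language_complement[OF s F] by simp
  with F have w: "blocks ?x (?w h) \<in> binary_language s" for h by (cases h) simp_all
  have "sublist (blocks ?x (replicate ?a h @ replicate (2 * ?a) (\<not> h))) (blocks ?x (?w h))" by simp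
  then show "blocks ?x (replicate ?a h @ replicate (2 * ?a) (\<not> h)) \<in> binary_language s"
    using w binary_language_sublist by blast
  have "sublist (blocks ?x (replicate (2 * ?a) h @ replicate ?a (\<not> h))) (blocks ?x (?w (\<not> h)))" by simp
  then show "blocks ?x (replicate (2 * ?a) h @ replicate ?a (\<not> h)) \<in> binary_language s"
    using w binary_language_sublist by blast
qed

text \<open>The length bound leaves at most one sign change in \<open>z\<close>. Without one,
  \<open>z\<close> fits into \<open>x\<close> to the power \<open>2 * s k\<close>, up to complement;
  with one, into a run of \<open>s k\<close> signs beside \<open>2 * s k\<close> opposite ones,
  ordered according to where the change happens.\<close>

lemma short_factors_in_language:
  assumes s: "\<forall>k. 0 < s k" and t: "\<forall>k. 0 < t k"
    and eq: "alpha t k = alpha s k" and lt: "s k < t k"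
    and z: "z \<in> binary_language t" "length z \<le> s k * length (alpha s k) + 2"
  shows "z \<in> binary_language s"
proof -
  define x q a b where "x = alpha s k" and "q = length x" and "a = s k" and "b = t k"
  have q: "2 \<le> q" using length_alpha_ge_2[OF s, of k] unfolding q_def x_def .
  have a: "0 < a" using s by (simp add: a_def)
  have aq: "q \<le> a * q" using a by simp
  have zl: "length z \<le> a * q + 2" using z(2) by (simp add: a_def q_def x_def)
  have "a * q + 2 \<le> Suc a * q" using q by simp
  also have "\<dots> \<le> q * b"
    using lt unfolding a_def b_def by (subst mult.commute) (intro mult_le_mono2, simp)
  finally have M: "length z \<le> q * b" "0 < q * b" using zl by linarith+
  obtain j H where H: "\<And>r. r < length z \<Longrightarrow>
      z ! r = (x ! ((j + r) mod q) \<noteq> H ((j + r) div (q * b)))"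
    using binary_language_nth[OF t z(1), of k] unfolding eq x_def q_def b_def by blast
  have dup: "blocks x (replicate (2 * a) h) \<in> binary_language s" for h
    using blocks_in_language(2)[OF s, of k h] binary_language_sublist
    by (metis a_def blocks_append sublist_append_rightI x_def)
  have q0: "0 < q" using q by simp
  have uniform: ?thesis if zh: "\<And>r. r < length z \<Longrightarrow> z ! r = (x ! ((j + r) mod q) \<noteq> h)" for h
  proof -
    obtain g where g: "0 < g" "q = 2 * g"
      and half: "\<And>n. x ! ((n + g) mod q) = (\<not> x ! (n mod q))"
      using nth_alpha_half_period[OF s, of k] unfolding q_def x_def by metis
    define i where "i = j mod q"
    have i: "i < q" using q0 by (simp add: i_def)
    have zi: "z ! r = (x ! ((i + r) mod q) \<noteq> h)" if "r < length z" for r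
      using zh[OF that] by (simp add: i_def mod_simps)
    have dup': "(i' + r) div q < 2 * a" if "i' + length z \<le> q * (2 * a)" "r < length z" for i' r
      using that q0 by (simp add: div_less_iff_less_mult mult.commute)
    have aqm: "q + a * q \<le> q * (2 * a)" using aq by (simp add: algebra_simps)
    show ?thesis
    proof (cases "i = q - 1")
      case False
      then have "i + length z \<le> q * (2 * a)" using i zl aqm by linarith
      then show ?thesis
        using zi dup' by (intro in_language_if_nth_blocks[OF dup[of "h"], of i]) (simp_all add: q_def)
    next
      \<comment> \<open>From this phase \<open>z\<close> could overrun the end by one letter. As
        \<open>q - 1 = (g - 1) + g\<close>, half a period back the same letters appear with the
        opposite sign, and there is room.\<close>
      case True
      have bound: "g - 1 + length z \<le> q * (2 * a)" using g zl aqm by linarith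
      have "z ! r = (x ! ((g - 1 + r) mod q) \<noteq> (\<not> h))" if "r < length z" for r
      proof -
        have "i + r = g - 1 + r + g" using True g by simp
        show ?thesis using zi[OF that] unfolding \<open>i + r = g - 1 + r + g\<close> half by simp
      qed
      with bound show ?thesis
        using dup' by (intro in_language_if_nth_blocks[OF dup[of "\<not> h"], of "g - 1"]) (simp_all add: q_def)
    qed
  qed
  show ?thesis
    using M
  proof (cases rule: block_boundary_cases[of "length z" "q * b" j])
    case (inside c)
    then show ?thesis using uniform[of "H c"] H by simp
  next
    case (cross c i)
    have "q dvd j + i" using cross(3) by (metis dvd_mult_left)
    then obtain l where l: "j + i = l * q" by (metis dvdE mult.commute)
    have shift: "(n * q - i + r) mod q = (j + r) mod q" if "i \<le> n * q" for n r
    proof -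
      have "n * q - i + r + l * q = j + r + n * q" using l that by linarith
      then show ?thesis by (metis mod_mult_self1)
    qed
    have three: "q * (3 * a) = 3 * (a * q)" by simp
    have switch: "(n * q - i + r) div q < n \<longleftrightarrow> \<not> i \<le> r" if "i \<le> n * q" for n r
      unfolding div_less_iff_less_mult[OF q0] using that by linarith
    have bound: "(i' + r) div q < 3 * a" if "i' + length z \<le> q * (3 * a)" "r < length z" for i' r
      using that q0 by (simp add: div_less_iff_less_mult mult.commute)
    have zr: "z ! r = (x ! ((j + r) mod q) \<noteq> (if i \<le> r then H (Suc c) else H c))"
      if "r < length z" for r using H[OF that] cross(4)[OF that] by simp
    show ?thesis
    proof (cases "H (Suc c) = H c")
      case True
      then show ?thesis using uniform[of "H c"] zr by simp
    next
      case False
      then have Hc: "H (Suc c) = (\<not> H c)" by blast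
      show ?thesis
      proof (cases "i \<le> a * q")
        case True
        have len: "a * q - i + length z \<le> q * (3 * a)"
          unfolding three using zl cross(1) aq q True by linarith
        have "z ! r = (x ! ((a * q - i + r) mod q) \<noteq>
            (replicate a (H c) @ replicate (2 * a) (\<not> H c)) ! ((a * q - i + r) div q))"
          if "r < length z" for r
          using zr[OF that] shift[OF True, of r] switch[OF True, of r] bound[OF len that]
          by (simp add: nth_append Hc)
        moreover have "blocks x (replicate a (H c) @ replicate (2 * a) (\<not> H c)) \<in> binary_language s"
          using blocks_in_language(1)[OF s, of k "H c"] by (simp only: x_def a_def)
        moreover have "a * q - i + length z \<le> length x * length (replicate a (H c) @ replicate (2 * a) (\<not> H c))"
          using len by (simp add: q_def)
        ultimately show ?thesis unfolding q_def by (rule in_language_if_nth_blocks[rotated 2])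
      next
        \<comment> \<open>Only \<open>i = a * q + 1\<close> remains; the part before the change
          exceeds \<open>a\<close> blocks, so the long run has to come first.\<close>
        case i: False
        then have "i = a * q + 1" using cross(2) zl by linarith
        then have le: "i \<le> 2 * a * q" using aq q by linarith
        have len: "2 * a * q - i + length z \<le> q * (3 * a)"
          unfolding three using zl \<open>i = a * q + 1\<close> aq q by linarith
        have "z ! r = (x ! ((2 * a * q - i + r) mod q) \<noteq>
            (replicate (2 * a) (H c) @ replicate a (\<not> H c)) ! ((2 * a * q - i + r) div q))"
          if "r < length z" for r
          using zr[OF that] shift[OF le, of r] switch[OF le, of r] bound[OF len that]
          by (simp add: nth_append Hc)
        moreover have "blocks x (replicate (2 * a) (H c) @ replicate a (\<not> H c)) \<in> binary_language s"
          using blocks_in_language(2)[OF s, of k "H c"] by (simp only: x_def a_def)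
        moreover have "2 * a * q - i + length z \<le> length x * length (replicate (2 * a) (H c) @ replicate a (\<not> H c))"
          using len by (simp add: q_def)
        ultimately show ?thesis unfolding q_def by (rule in_language_if_nth_blocks[rotated 2])
      qed
    qed
  qed
qed

section \<open>Point sets up to order isomorphism\<close>

definition same_order :: "nat set \<Rightarrow> (nat \<Rightarrow> real \<times> real) \<Rightarrow> (nat \<Rightarrow> real \<times> real) \<Rightarrow> bool" where
  "same_order A f h \<longleftrightarrow> (\<forall>i\<in>A. \<forall>j\<in>A.
     (fst (f i) < fst (f j) \<longleftrightarrow> fst (h i) < fst (h j)) \<and>
     (snd (f i) < snd (f j) \<longleftrightarrow> snd (h i) < snd (h j)))"

lemma same_orderD:
  assumes "same_order A f h" "i \<in> A" "j \<in> A"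
  shows "fst (f i) < fst (f j) \<longleftrightarrow> fst (h i) < fst (h j)"
    "snd (f i) < snd (f j) \<longleftrightarrow> snd (h i) < snd (h j)"
  using assms by (auto simp: same_order_def)

lemma same_orderI:
  assumes inj: "inj_on (fst \<circ> f) A" "inj_on (snd \<circ> f) A" "inj_on (fst \<circ> h) A" "inj_on (snd \<circ> h) A"
    and fst: "\<And>i j. i \<in> A \<Longrightarrow> j \<in> A \<Longrightarrow> i < j \<Longrightarrow> fst (f i) < fst (f j) \<longleftrightarrow> fst (h i) < fst (h j)"
    and snd: "\<And>i j. i \<in> A \<Longrightarrow> j \<in> A \<Longrightarrow> i < j \<Longrightarrow> snd (f i) < snd (f j) \<longleftrightarrow> snd (h i) < snd (h j)"
  shows "same_order A f h"
  unfolding same_order_def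
proof (intro ballI)
  fix i j assume ij: "i \<in> A" "j \<in> A"
  show "(fst (f i) < fst (f j) \<longleftrightarrow> fst (h i) < fst (h j)) \<and>
     (snd (f i) < snd (f j) \<longleftrightarrow> snd (h i) < snd (h j))"
  proof (cases i j rule: linorder_cases)
    case greater
    have "fst (f i) \<noteq> fst (f j)" "snd (f i) \<noteq> snd (f j)" "fst (h i) \<noteq> fst (h j)" "snd (h i) \<noteq> snd (h j)"
      using inj ij greater by (auto simp: inj_on_def)
    then show ?thesis using fst[OF ij(2,1) greater] snd[OF ij(2,1) greater] by linarith
  qed (use fst snd ij in auto)
qed

lemma points_order_iso_cong:
  assumes same: "same_order A f h" and inj: "inj_on f A" and iso: "points_order_iso (f ` A) \<pi>"
  shows "points_order_iso (h ` A) \<pi>"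
proof -
  obtain ps where ps: "set ps = f ` A" "sorted_wrt (\<lambda>p q. fst p < fst q) ps" "order_iso (map snd ps) \<pi>"
    using iso by (auto simp: points_order_iso_def)
  define ks where "ks = map (inv_into A f) ps"
  have ps_eq: "ps = map f ks"
    unfolding ks_def map_map using ps(1) by (intro map_idI[symmetric]) (auto simp: f_inv_into_f)
  have ks: "set ks = A"
    unfolding ks_def set_map ps(1) using inj by (simp add: inj_on_def image_image inv_into_f_f)
  have "sorted_wrt (\<lambda>i j. fst (f i) < fst (f j)) ks" using ps(2) by (simp add: ps_eq sorted_wrt_map)
  then have "sorted_wrt (\<lambda>i j. fst (h i) < fst (h j)) ks"
    by (rule sorted_wrt_mono_rel[rotated]) (use same ks in \<open>auto simp: same_order_def\<close>)
  moreover have "order_iso (map (snd \<circ> h) ks) \<pi>"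
    unfolding order_iso_def
  proof (intro conjI allI impI)
    show "length (map (snd \<circ> h) ks) = length \<pi>" using ps(3) by (simp add: order_iso_def ps_eq)
    fix i j assume "i < length (map (snd \<circ> h) ks)" "j < length (map (snd \<circ> h) ks)"
    then have ij: "i < length ks" "j < length ks" by auto
    then have "ks ! i \<in> A" "ks ! j \<in> A" using ks nth_mem by blast+
    then show "(map (snd \<circ> h) ks ! i < map (snd \<circ> h) ks ! j) = (\<pi> ! i < \<pi> ! j)"
      using ps(3) ij same_orderD(2)[OF same, of "ks ! i" "ks ! j"]
      by (simp add: order_iso_def ps_eq)
  qed
  ultimately show ?thesis
    unfolding points_order_iso_def
    by (intro exI[of _ "map h ks"]) (simp add: ks sorted_wrt_map)
qed

lemma distinct_if_sorted_wrt_irrefl: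
  assumes "\<And>x. \<not> P x x"
  shows "sorted_wrt P xs \<Longrightarrow> distinct xs"
  using assms by (induction xs) auto

text \<open>\<open>\<theta>\<close> matches points of equal rank from the left; the heights then
  agree because both follow \<open>\<pi>\<close>.\<close>

lemma points_order_iso_bij:
  assumes A: "points_order_iso (f ` A) \<pi>" "inj_on f A" and B: "points_order_iso (g ` B) \<pi>" "inj_on g B"
  obtains \<theta> where "bij_betw \<theta> A B" "same_order A f (g \<circ> \<theta>)"
proof -
  obtain ps where ps: "set ps = f ` A" "sorted_wrt (\<lambda>p q. fst p < fst q) ps" "order_iso (map snd ps) \<pi>"
    using A by (auto simp: points_order_iso_def)
  obtain qs where qs: "set qs = g ` B" "sorted_wrt (\<lambda>p q. fst p < fst q) qs" "order_iso (map snd qs) \<pi>"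
    using B by (auto simp: points_order_iso_def)
  have len: "length ps = length \<pi>" "length qs = length \<pi>" using ps qs by (auto simp: order_iso_def)
  have "distinct ps" "distinct qs"
    using ps(2) qs(2) by (auto intro: distinct_if_sorted_wrt_irrefl[rotated])
  then have nth: "bij_betw (nth ps) {..<length \<pi>} (f ` A)" "bij_betw (nth qs) {..<length \<pi>} (g ` B)"
    using bij_betw_nth ps(1) qs(1) len by metis+
  define \<kappa> where "\<kappa> = inv_into {..<length \<pi>} (nth ps) \<circ> f"
  have \<kappa>: "bij_betw \<kappa> A {..<length \<pi>}"
    unfolding \<kappa>_def using A(2) nth(1)
    by (intro bij_betw_trans[of f A "f ` A"]) (auto simp: inj_on_imp_bij_betw intro: bij_betw_inv_into)
  have ps\<kappa>: "ps ! \<kappa> i = f i" if "i \<in> A" for i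
    unfolding \<kappa>_def comp_def using nth(1) that by (simp add: bij_betw_inv_into_right)
  define \<theta> where "\<theta> = inv_into B g \<circ> (nth qs \<circ> \<kappa>)"
  have "bij_betw (nth qs \<circ> \<kappa>) A (g ` B)" using bij_betw_trans[OF \<kappa> nth(2)] .
  then have "bij_betw \<theta> A B" unfolding \<theta>_def
    by (rule bij_betw_trans) (use B(2) in \<open>simp add: bij_betw_inv_into inj_on_imp_bij_betw\<close>)
  have g\<theta>: "g (\<theta> i) = qs ! \<kappa> i" and \<kappa>l: "\<kappa> i < length \<pi>" if "i \<in> A" for i
  proof -
    show "\<kappa> i < length \<pi>" using \<kappa> that by (auto simp: bij_betw_def)
    then have "qs ! \<kappa> i \<in> g ` B" using nth(2) by (auto simp: bij_betw_def)
    then show "g (\<theta> i) = qs ! \<kappa> i" by (simp add: \<theta>_def f_inv_into_f)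
  qed
  have cmp: "fst (rs ! k) < fst (rs ! l) \<longleftrightarrow> k < l"
    if "sorted_wrt (\<lambda>p q. fst p < fst q) rs" "k < length rs" "l < length rs"
    for rs :: "(real \<times> real) list" and k l
    using that sorted_wrt_nth_less[OF that(1), of k l] sorted_wrt_nth_less[OF that(1), of l k]
    by (cases k l rule: linorder_cases) auto
  have "same_order A f (g \<circ> \<theta>)"
    unfolding same_order_def
  proof (intro ballI)
    fix i j assume ij: "i \<in> A" "j \<in> A"
    have "fst (f i) < fst (f j) \<longleftrightarrow> \<kappa> i < \<kappa> j"
      using cmp[OF ps(2), of "\<kappa> i" "\<kappa> j"] ps\<kappa> \<kappa>l ij len by simp
    moreover have "fst (g (\<theta> i)) < fst (g (\<theta> j)) \<longleftrightarrow> \<kappa> i < \<kappa> j"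
      using cmp[OF qs(2), of "\<kappa> i" "\<kappa> j"] g\<theta> \<kappa>l ij len by simp
    moreover have "snd (f i) < snd (f j) \<longleftrightarrow> \<pi> ! \<kappa> i < \<pi> ! \<kappa> j"
      using ps(3) ps\<kappa>[OF ij(1)] ps\<kappa>[OF ij(2)] \<kappa>l[OF ij(1)] \<kappa>l[OF ij(2)] len
      by (simp add: order_iso_def) metis
    moreover have "snd (g (\<theta> i)) < snd (g (\<theta> j)) \<longleftrightarrow> \<pi> ! \<kappa> i < \<pi> ! \<kappa> j"
      using qs(3) g\<theta>[OF ij(1)] g\<theta>[OF ij(2)] \<kappa>l[OF ij(1)] \<kappa>l[OF ij(2)] len
      by (simp add: order_iso_def)
    ultimately show "(fst (f i) < fst (f j) \<longleftrightarrow> fst ((g \<circ> \<theta>) i) < fst ((g \<circ> \<theta>) j)) \<and>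
       (snd (f i) < snd (f j) \<longleftrightarrow> snd ((g \<circ> \<theta>) i) < snd ((g \<circ> \<theta>) j))" by simp
  qed
  with \<open>bij_betw \<theta> A B\<close> show thesis by (rule that)
qed

section \<open>Existence and uniqueness of the permutation of a point set\<close>

lemma is_perm_iff: "is_perm \<pi> \<longleftrightarrow> set \<pi> = {1..length \<pi>} \<and> distinct \<pi>"
  by (auto simp: is_perm_def permutations_of_set_def)

lemma order_iso_sym: "order_iso xs ys \<Longrightarrow> order_iso ys xs"
  and order_iso_trans: "order_iso xs ys \<Longrightarrow> order_iso ys zs \<Longrightarrow> order_iso xs zs"
  by (auto simp: order_iso_def)

text \<open>An entry of a permutation equals the number of entries not exceeding it, which
  comparisons alone determine.\<close>

lemma perm_eq_if_order_iso:
  assumes "is_perm \<pi>" "is_perm \<sigma>" "order_iso \<pi> \<sigma>"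
  shows "\<pi> = \<sigma>"
proof (rule nth_equalityI)
  show len: "length \<pi> = length \<sigma>" using assms(3) by (simp add: order_iso_def)
  have rank: "\<tau> ! i = card {j. j < length \<tau> \<and> \<not> \<tau> ! i < \<tau> ! j}"
    if \<tau>: "is_perm \<tau>" and i: "i < length \<tau>" for \<tau> i
  proof -
    have "(\<lambda>j. \<tau> ! j) ` {j. j < length \<tau> \<and> \<not> \<tau> ! i < \<tau> ! j} = {z \<in> set \<tau>. z \<le> \<tau> ! i}"
      by (auto simp: in_set_conv_nth)
    also have "\<dots> = {1..\<tau> ! i}"
      using \<tau> nth_mem[OF i] unfolding is_perm_iff by auto
    finally have "card ((\<lambda>j. \<tau> ! j) ` {j. j < length \<tau> \<and> \<not> \<tau> ! i < \<tau> ! j}) = \<tau> ! i" by simp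
    moreover have "inj_on (\<lambda>j. \<tau> ! j) {j. j < length \<tau> \<and> \<not> \<tau> ! i < \<tau> ! j}"
      using \<tau> by (auto simp: is_perm_iff inj_on_def nth_eq_iff_index_eq)
    ultimately show ?thesis by (simp add: card_image)
  qed
  fix i assume i: "i < length \<pi>"
  have "{j. j < length \<pi> \<and> \<not> \<pi> ! i < \<pi> ! j} = {j. j < length \<sigma> \<and> \<not> \<sigma> ! i < \<sigma> ! j}"
    using assms(3) i by (auto simp: order_iso_def)
  then show "\<pi> ! i = \<sigma> ! i" using rank[OF assms(1), of i] rank[OF assms(2), of i] i len by simp
qed

lemma points_order_iso_unique:
  assumes "points_order_iso S \<pi>" "points_order_iso S \<sigma>"
  shows "order_iso \<pi> \<sigma>"
proof -
  obtain ps where ps: "set ps = S" "sorted_wrt (\<lambda>p q. fst p < fst q) ps" "order_iso (map snd ps) \<pi>"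
    using assms by (auto simp: points_order_iso_def)
  obtain qs where qs: "set qs = S" "sorted_wrt (\<lambda>p q. fst p < fst q) qs" "order_iso (map snd qs) \<sigma>"
    using assms by (auto simp: points_order_iso_def)
  have s: "sorted_wrt (<) (map fst ps)" "sorted_wrt (<) (map fst qs)"
    using ps(2) qs(2) by (simp_all add: sorted_wrt_map)
  have "map fst ps = map fst qs"
    by (rule strict_sorted_equal) (use s ps(1) qs(1) in simp_all)
  moreover have "inj_on fst (set ps \<union> set qs)"
    using s(1) ps(1) qs(1) by (simp add: strict_sorted_iff distinct_map)
  ultimately have "ps = qs" by (metis inj_on_map_eq_map)
  then show ?thesis using ps(3) qs(3) order_iso_sym order_iso_trans by blast
qed

lemma points_order_iso_exists:
  assumes "finite S" "inj_on fst S" "inj_on snd S"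
  shows "\<exists>\<pi>. is_perm \<pi> \<and> points_order_iso S \<pi>"
proof -
  define ps where "ps = map (inv_into S fst) (sorted_list_of_set (fst ` S))"
  have ps: "set ps = S"
    using assms by (simp add: ps_def image_image inv_into_f_f)
  have "map fst ps = sorted_list_of_set (fst ` S)"
    unfolding ps_def map_map using assms(1) by (intro map_idI) (auto simp: f_inv_into_f)
  then have sorted: "sorted_wrt (\<lambda>p q. fst p < fst q) ps"
    using strict_sorted_list_of_set[of "fst ` S"] by (simp flip: sorted_wrt_map)
  then have "distinct ps" by (rule distinct_if_sorted_wrt_irrefl[rotated]) simp
  define ys where "ys = map snd ps"
  have ys: "distinct ys" using \<open>distinct ps\<close> assms(3) by (simp add: ys_def distinct_map ps)
  define rk where "rk y = card {z \<in> set ys. z \<le> y}" for y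
  have rk_less: "rk y < rk y' \<longleftrightarrow> y < y'" if "y \<in> set ys" "y' \<in> set ys" for y y'
  proof (cases "y < y'")
    case True
    have "{z \<in> set ys. z \<le> y} \<subseteq> {z \<in> set ys. z \<le> y'}" "y' \<notin> {z \<in> set ys. z \<le> y}"
      "y' \<in> {z \<in> set ys. z \<le> y'}"
      using True that by auto
    then have "{z \<in> set ys. z \<le> y} \<subset> {z \<in> set ys. z \<le> y'}" by blast
    then show ?thesis using True unfolding rk_def by (simp add: psubset_card_mono)
  next
    case False
    then have "{z \<in> set ys. z \<le> y'} \<subseteq> {z \<in> set ys. z \<le> y}" by auto
    then have "rk y' \<le> rk y" unfolding rk_def by (simp add: card_mono)
    with False show ?thesis by simp
  qed
  have inj: "inj_on rk (set ys)"
  proof (rule inj_onI)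
    fix y y' assume "y \<in> set ys" "y' \<in> set ys" "rk y = rk y'"
    then show "y = y'" using rk_less[of y y'] rk_less[of y' y] by auto
  qed
  have "rk ` set ys = {1..length ys}"
  proof (rule card_subset_eq)
    show "rk ` set ys \<subseteq> {1..length ys}"
    proof
      fix n assume "n \<in> rk ` set ys"
      then obtain y where y: "y \<in> set ys" "n = rk y" by blast
      have "rk y \<le> card (set ys)" unfolding rk_def by (intro card_mono) auto
      moreover have "0 < rk y" unfolding rk_def using y(1) by (auto simp: card_gt_0_iff)
      ultimately show "n \<in> {1..length ys}" using y(2) ys by (simp add: distinct_card)
    qed
    show "card (rk ` set ys) = card {1..length ys}"
      using inj ys by (simp add: card_image distinct_card)
  qed simp
  then have "is_perm (map rk ys)" using ys inj by (simp add: is_perm_iff distinct_map)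
  moreover have "order_iso ys (map rk ys)" by (simp add: order_iso_def rk_less)
  ultimately show ?thesis unfolding points_order_iso_def using ps sorted ys_def by blast
qed

lemma order_iso_nths:
  assumes "order_iso xs ys"
  shows "order_iso (nths xs I) (nths ys I)"
proof -
  define zs where "zs = zip xs ys"
  have len: "length xs = length ys" using assms by (simp add: order_iso_def)
  then have z: "xs = map fst zs" "ys = map snd zs" by (simp_all add: zs_def)
  have "fst p < fst q \<longleftrightarrow> snd p < snd q" if "p \<in> set zs" "q \<in> set zs" for p q
  proof -
    have "\<forall>i<length zs. \<forall>j<length zs.
        fst (zs ! i) < fst (zs ! j) \<longleftrightarrow> snd (zs ! i) < snd (zs ! j)"
      using assms unfolding z order_iso_def by simp
    then show ?thesis using that unfolding in_set_conv_nth by blast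
  qed
  moreover have "set (nths zs I) \<subseteq> set zs" by (rule set_nths_subset)
  ultimately have "fst (nths zs I ! i) < fst (nths zs I ! j) \<longleftrightarrow> snd (nths zs I ! i) < snd (nths zs I ! j)"
    if "i < length (nths zs I)" "j < length (nths zs I)" for i j
    using that nth_mem by blast
  then show ?thesis by (simp add: order_iso_def z nths_map)
qed

lemma sorted_wrt_nths: "sorted_wrt P xs \<Longrightarrow> sorted_wrt P (nths xs I)"
proof (induction xs arbitrary: I)
  case (Cons x xs)
  have "set (nths xs J) \<subseteq> set xs" for J by (rule set_nths_subset)
  then show ?case using Cons by (auto simp: nths_Cons)
qed simp

lemma contains_iff_subset:
  assumes "points_order_iso S \<pi>"
  shows "contains \<pi> \<sigma> \<longleftrightarrow> (\<exists>T\<subseteq>S. points_order_iso T \<sigma>)"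
proof
  obtain ps where ps: "set ps = S" "sorted_wrt (\<lambda>p q. fst p < fst q) ps" "order_iso (map snd ps) \<pi>"
    using assms by (auto simp: points_order_iso_def)
  {
    assume "contains \<pi> \<sigma>"
    then obtain I where I: "order_iso (nths \<pi> I) \<sigma>"
      by (auto simp: contains_def subseq_conv_nths)
    have "order_iso (map snd (nths ps I)) \<sigma>"
      using order_iso_trans[OF order_iso_nths[OF ps(3)] I] by (simp add: nths_map)
    moreover have "sorted_wrt (\<lambda>p q. fst p < fst q) (nths ps I)"
      using ps(2) by (rule sorted_wrt_nths)
    ultimately have "points_order_iso (set (nths ps I)) \<sigma>"
      unfolding points_order_iso_def by (intro exI[of _ "nths ps I"]) simp
    moreover have "set (nths ps I) \<subseteq> S" using set_nths_subset[of ps I] unfolding ps(1) .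
    ultimately show "\<exists>T\<subseteq>S. points_order_iso T \<sigma>" by blast
  }
  assume "\<exists>T\<subseteq>S. points_order_iso T \<sigma>"
  then obtain T qs where T: "T \<subseteq> S" and qs: "set qs = T" "sorted_wrt (\<lambda>p q. fst p < fst q) qs"
    "order_iso (map snd qs) \<sigma>" by (auto simp: points_order_iso_def)
  have "qs = filter (\<lambda>p. p \<in> T) ps"
  proof -
    have fs: "sorted_wrt (\<lambda>p q. fst p < fst q) (filter (\<lambda>p. p \<in> T) ps)"
      using ps(2) by (rule sorted_wrt_filter)
    have "map fst qs = map fst (filter (\<lambda>p. p \<in> T) ps)"
      by (rule strict_sorted_equal) (use qs fs T ps(1) in \<open>auto simp: sorted_wrt_map\<close>)
    moreover have "inj_on fst (set ps)"
      using ps(2) by (simp add: strict_sorted_iff distinct_map flip: sorted_wrt_map)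
    ultimately show ?thesis using T qs(1) ps(1)
      by (metis (no_types, lifting) filter_is_subset inj_on_map_eq_map inj_on_subset le_sup_iff)
  qed
  then have "subseq (map snd qs) (map snd ps)" by (simp add: subseq_map subseq_filter_left)
  then obtain I where "map snd qs = nths (map snd ps) I" by (auto simp: subseq_conv_nths)
  then have "order_iso (nths \<pi> I) \<sigma>"
    using order_iso_nths[OF ps(3), of I] qs(3) order_iso_sym order_iso_trans by metis
  then show "contains \<pi> \<sigma>" unfolding contains_def subseq_conv_nths by blast
qed

section \<open>Pin sequences\<close>

text \<open>Explicit coordinates for the pins of \<open>rho x\<close>: pin \<open>n\<close> belongs to the letter \<open>x ! (n div 2)\<close>, the
  even pins being the vertical ones. A vertical pin lies just to the left of the preceding horizontal pin,
  and a horizontal pin vertically just inside the preceding vertical one; this is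
  why one of the two coordinates is shifted by 2. The initial point \<open>p\<^sub>0\<close> can be placed at \<open>(-1, 0)\<close>.\<close>

definition pin_point :: "bool list \<Rightarrow> nat \<Rightarrow> real \<times> real" where
  "pin_point x n = (real (if even n then n else n + 2),
     (if x ! (n div 2) then 1 else -1) * real (if even n then n + 2 else n))"

text \<open>The shift by 2 makes a single exception to the left-to-right order: a vertical pin and
  the horizontal pin just before it.\<close>

lemma fst_pin_point_less_iff:
  "m < n \<Longrightarrow> fst (pin_point x m) < fst (pin_point x n) \<longleftrightarrow> \<not> (n = Suc m \<and> even n)"
proof -
  assume "m < n"
  have "(if even m then m else m + 2) < (if even n then n else n + 2) \<longleftrightarrow> \<not> (n = Suc m \<and> even n)"
  proof (cases "odd m \<and> even n")
    case True
    then show ?thesis using \<open>m < n\<close> by simp presburger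
  next
    case False
    then show ?thesis using \<open>m < n\<close> by auto
  qed
  then show ?thesis by (simp only: pin_point_def fst_conv of_nat_less_iff)
qed

text \<open>Usually the later pin has the larger absolute height, so its letter decides. The
  exception is a horizontal pin right after the vertical pin of the same letter.\<close>

lemma snd_pin_point_less_iff:
  assumes "m < n"
  shows "snd (pin_point x m) < snd (pin_point x n) \<longleftrightarrow> x ! (n div 2) \<noteq> (n = Suc m \<and> odd n)"
proof (cases "n = Suc m \<and> odd n")
  case True
  then obtain k where "n = Suc (2 * k)" using oddE by (metis Suc_eq_plus1)
  moreover from this True have "m = 2 * k" by simp
  ultimately show ?thesis by (simp add: pin_point_def)
next
  case False
  have "even m \<Longrightarrow> odd n \<Longrightarrow> m + 2 < n" using assms False by presburger
  then have "(if even m then m + 2 else m) < (if even n then n + 2 else n)"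
    using assms by auto
  then have "\<bar>snd (pin_point x m)\<bar> < real (if even n then n + 2 else n)"
    by (auto simp: pin_point_def abs_mult simp del: of_nat_add)
  then show ?thesis using False by (auto simp: pin_point_def)
qed

lemma inj_fst_pin_point: "inj (fst \<circ> pin_point x)"
proof (rule injI)
  fix m n assume "(fst \<circ> pin_point x) m = (fst \<circ> pin_point x) n"
  then have "(if even m then m else m + 2) = (if even n then n else n + 2)"
    by (simp only: pin_point_def fst_conv of_nat_eq_iff comp_def)
  then show "m = n" by (auto split: if_splits)
qed

lemma inj_snd_pin_point: "inj (snd \<circ> pin_point x)"
proof (rule injI)
  fix m n assume "(snd \<circ> pin_point x) m = (snd \<circ> pin_point x) n"
  then have "\<bar>snd (pin_point x m)\<bar> = \<bar>snd (pin_point x n)\<bar>" by simp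
  then have "real (if even m then m + 2 else m) = real (if even n then n + 2 else n)"
    by (auto simp: pin_point_def abs_mult simp del: of_nat_add split: if_splits)
  then have "(if even m then m + 2 else m) = (if even n then n + 2 else n)" by (simp only: of_nat_eq_iff)
  then show "m = n" by (auto split: if_splits)
qed

lemma inj_pin_point: "inj (pin_point x)"
  using inj_fst_pin_point by (rule inj_on_imageI2)

section \<open>Pin sequences for factors of rho\<close>

lemma length_rho [simp]: "length (rho x) = 2 * length x"
  by (induction x) (auto simp: rho_def)

lemma nth_rho:
  "n < 2 * length x \<Longrightarrow> rho x ! n = (if even n then if x ! (n div 2) then Up else Down
     else if x ! (n div 2) then RightU else RightD)"
proof (induction x arbitrary: n)
  case (Cons b x)
  have r: "rho (b # x) = (if b then [Up, RightU] else [Down, RightD]) @ rho x" by (simp add: rho_def)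
  consider "n = 0" | "n = 1" | m where "n = Suc (Suc m)" by (metis One_nat_def not0_implies_Suc)
  then show ?case
  proof cases
    case 3
    then show ?thesis using Cons.IH[of m] Cons.prems unfolding r by auto
  qed (simp_all add: r)
qed simp

lemma rect_hull_superset: "finite S \<Longrightarrow> S \<subseteq> rect_hull S"
  unfolding rect_hull_def by (intro subsetI) (simp add: mem_Times_iff)

lemma rect_hull_less:
  assumes "finite I" "I \<noteq> {}" "r \<in> rect_hull (f ` I)"
  shows "\<forall>i\<in>I. fst (f i) < a \<Longrightarrow> fst r < a" "\<forall>i\<in>I. a < fst (f i) \<Longrightarrow> a < fst r"
    "\<forall>i\<in>I. snd (f i) < a \<Longrightarrow> snd r < a" "\<forall>i\<in>I. a < snd (f i) \<Longrightarrow> a < snd r"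
proof -
  have ne: "finite (fst ` f ` I)" "fst ` f ` I \<noteq> {}" "finite (snd ` f ` I)" "snd ` f ` I \<noteq> {}"
    using assms by auto
  have r: "Min (fst ` f ` I) \<le> fst r" "fst r \<le> Max (fst ` f ` I)"
    "Min (snd ` f ` I) \<le> snd r" "snd r \<le> Max (snd ` f ` I)"
    using assms(3) by (auto simp: rect_hull_def mem_Times_iff)
  show "fst r < a" if "\<forall>i\<in>I. fst (f i) < a" using that r(2) Max_in[OF ne(1,2)] by fastforce
  show "a < fst r" if "\<forall>i\<in>I. a < fst (f i)" using that r(1) Min_in[OF ne(1,2)] by fastforce
  show "snd r < a" if "\<forall>i\<in>I. snd (f i) < a" using that r(4) Max_in[OF ne(3,4)] by fastforce
  show "a < snd r" if "\<forall>i\<in>I. a < snd (f i)" using that r(3) Min_in[OF ne(3,4)] by fastforce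
qed

text \<open>The letters \<open>w\<close> form a factor of \<open>rho x\<close> starting at position \<open>d\<close>, so that the point \<open>p (Suc i)\<close>
  plays the role of \<open>pin_point x (d + i)\<close>.\<close>

context
  fixes x :: "bool list" and w :: "pin list" and d :: nat
  assumes w: "\<And>i. i < length w \<Longrightarrow> w ! i = rho x ! (d + i)"
    and len: "d + length w \<le> 2 * length x"
begin

lemma nth_w:
  assumes "i < length w"
  shows "w ! i = (if even (d + i) then if x ! ((d + i) div 2) then Up else Down
     else if x ! ((d + i) div 2) then RightU else RightD)"
  using w[OF assms] nth_rho[of "d + i" x] len assms by simp

lemma pin_sequence_step:
  assumes p: "pin_sequence w p" and j: "0 < j" "j < length w"
  defines "old \<equiv> rect_hull (p ` {..j - 1})" and "new \<equiv> rect_hull (p ` {..j})"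
  shows "horizontally_between (p (Suc j)) (p j) old \<or> vertically_between (p (Suc j)) (p j) old"
    and "case w ! j of Up \<Rightarrow> above (p (Suc j)) new | Down \<Rightarrow> below (p (Suc j)) new
           | RightU \<Rightarrow> right_of (p (Suc j)) new | RightD \<Rightarrow> right_of (p (Suc j)) new"
    and "\<And>i. i < j \<Longrightarrow> p i \<in> old" and "\<And>i. i \<le> j \<Longrightarrow> p i \<in> new"
proof -
  have "Suc j \<in> {2..length w}" using j by auto
  then have "let old = rect_hull (p ` {..Suc j - 2}); new = rect_hull (p ` {..Suc j - 1}) in
          p (Suc j) \<notin> new \<and>
          (horizontally_between (p (Suc j)) (p (Suc j - 1)) old \<or> vertically_between (p (Suc j)) (p (Suc j - 1)) old) \<and>
          (case w ! (Suc j - 1) of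
             Up \<Rightarrow> above (p (Suc j)) new
           | Down \<Rightarrow> below (p (Suc j)) new
           | RightU \<Rightarrow> right_of (p (Suc j)) new
           | RightD \<Rightarrow> right_of (p (Suc j)) new)"
    using p unfolding pin_sequence_def by blast
  moreover have e: "Suc j - 2 = j - 1" "Suc j - 1 = j" by simp_all
  ultimately show "horizontally_between (p (Suc j)) (p j) old \<or> vertically_between (p (Suc j)) (p j) old"
    and "case w ! j of Up \<Rightarrow> above (p (Suc j)) new | Down \<Rightarrow> below (p (Suc j)) new
           | RightU \<Rightarrow> right_of (p (Suc j)) new | RightD \<Rightarrow> right_of (p (Suc j)) new"
    unfolding Let_def old_def new_def e by blast+
  show "p i \<in> old" if "i < j" for i
    unfolding old_def using rect_hull_superset[of "p ` {..j - 1}"] that by auto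
  show "p i \<in> new" if "i \<le> j" for i
    unfolding new_def using rect_hull_superset[of "p ` {..j}"] that by auto
qed

lemma pin_sequence_extremal:
  assumes p: "pin_sequence w p" and j: "j < length w" and i: "i \<le> j"
  shows "even (d + j) \<Longrightarrow> if x ! ((d + j) div 2) then snd (p i) < snd (p (Suc j)) else snd (p (Suc j)) < snd (p i)"
    and "j = 0 \<or> odd (d + j) \<Longrightarrow> fst (p i) < fst (p (Suc j))"
proof (atomize (full), cases "j = 0")
  case True
  have "right_of (p 1) {p 0} \<and> (if w ! 0 \<in> {Up, RightU} then above (p 1) {p 0} else below (p 1) {p 0})"
  proof -
    have "1 \<le> length w" using j by simp
    then show ?thesis using p unfolding pin_sequence_def by blast
  qed
  moreover have "w ! 0 = (if even d then if x ! (d div 2) then Up else Down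
     else if x ! (d div 2) then RightU else RightD)" using nth_w[of 0] j True by simp
  ultimately show "(even (d + j) \<longrightarrow>
      (if x ! ((d + j) div 2) then snd (p i) < snd (p (Suc j)) else snd (p (Suc j)) < snd (p i))) \<and>
    (j = 0 \<or> odd (d + j) \<longrightarrow> fst (p i) < fst (p (Suc j)))"
    using True i by (auto simp: above_def below_def right_of_def)
next
  case False
  then have "0 < j" by simp
  note step = pin_sequence_step[OF p this j]
  show "(even (d + j) \<longrightarrow>
      (if x ! ((d + j) div 2) then snd (p i) < snd (p (Suc j)) else snd (p (Suc j)) < snd (p i))) \<and>
    (j = 0 \<or> odd (d + j) \<longrightarrow> fst (p i) < fst (p (Suc j)))"
    using step(2) step(4)[OF i] \<open>0 < j\<close> unfolding nth_w[OF j]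
    by (auto simp: above_def below_def right_of_def split: if_splits)
qed

text \<open>A vertical pin lies beyond the hull vertically, so it must separate \<open>p j\<close>
  from the old hull horizontally; as \<open>p j\<close> was placed on the right, the new pin falls
  between. Horizontal pins are treated likewise. Index \<open>0\<close> is excluded since
  \<open>p 0\<close> lies to the left of \<open>p 1\<close> even for a vertical first
  letter.\<close>

lemma pin_sequence_order:
  assumes p: "pin_sequence w p" and j: "j < length w" and i: "0 < i" "i \<le> j"
  shows "fst (p i) < fst (p (Suc j)) \<longleftrightarrow> \<not> (i = j \<and> even (d + j))"
    and "snd (p i) < snd (p (Suc j)) \<longleftrightarrow> x ! ((d + j) div 2) \<noteq> (i = j \<and> odd (d + j))"
proof -
  have j0: "0 < j" using i by simp
  note step = pin_sequence_step[OF p j0 j] and ext = pin_sequence_extremal[OF p j]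
  obtain j' where j': "j = Suc j'" using j0 by (cases j) auto
  have prev: "j' < length w" "0 \<le> j'" using j by (simp_all add: j')
  note ext' = pin_sequence_extremal[OF p prev]
  \<comment> \<open>Comparisons with \<open>p 0\<close>, a point of the old hull, rule out the wrong
    kind of separation and the wrong side.\<close>
  have i0: "p 0 \<in> rect_hull (p ` {..j - 1})" using step(3)[of 0] j0 by simp
  show "fst (p i) < fst (p (Suc j)) \<longleftrightarrow> \<not> (i = j \<and> even (d + j))"
  proof (cases "even (d + j)")
    case False
    then show ?thesis using ext(2)[OF i(2)] by simp
  next
    case True
    then have "odd (d + j')" by (simp add: j')
    then have 0: "fst (p 0) < fst (p j)" using ext'(2) by (simp add: j')
    have "\<not> vertically_between (p (Suc j)) (p j) (rect_hull (p ` {..j - 1}))"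
    proof (cases "x ! ((d + j) div 2)")
      case c: True
      then have "snd (p 0) < snd (p (Suc j))" "snd (p j) < snd (p (Suc j))"
        using ext(1)[of 0] ext(1)[of j] True by auto
      then show ?thesis unfolding vertically_between_def using i0 by (meson less_asym)
    next
      case c: False
      then have "snd (p (Suc j)) < snd (p 0)" "snd (p (Suc j)) < snd (p j)"
        using ext(1)[of 0] ext(1)[of j] True by auto
      then show ?thesis unfolding vertically_between_def using i0 by (meson less_asym)
    qed
    then have "\<forall>r\<in>rect_hull (p ` {..j - 1}). fst r < fst (p (Suc j)) \<and> fst (p (Suc j)) < fst (p j)"
      using step(1) 0 i0 unfolding horizontally_between_def by (meson less_asym less_trans)
    then show ?thesis using step(3)[of i] i0 i True by (cases "i = j") auto
  qed
  show "snd (p i) < snd (p (Suc j)) \<longleftrightarrow> x ! ((d + j) div 2) \<noteq> (i = j \<and> odd (d + j))"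
  proof (cases "odd (d + j)")
    case False
    then show ?thesis using ext(1)[OF i(2)] by (auto split: if_splits)
  next
    case True
    then have "even (d + j')" "(d + j) div 2 = (d + j') div 2" by (auto simp: j')
    then have 0: "if x ! ((d + j) div 2) then snd (p 0) < snd (p j) else snd (p j) < snd (p 0)"
      using ext'(1) by (simp add: j')
    have "\<not> horizontally_between (p (Suc j)) (p j) (rect_hull (p ` {..j - 1}))"
    proof -
      have "fst (p 0) < fst (p (Suc j))" "fst (p j) < fst (p (Suc j))"
        using ext(2)[of 0] ext(2)[of j] True by auto
      then show ?thesis unfolding horizontally_between_def using i0 by (meson less_asym)
    qed
    then have "if x ! ((d + j) div 2)
        then \<forall>r\<in>rect_hull (p ` {..j - 1}). snd r < snd (p (Suc j)) \<and> snd (p (Suc j)) < snd (p j)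
        else \<forall>r\<in>rect_hull (p ` {..j - 1}). snd (p j) < snd (p (Suc j)) \<and> snd (p (Suc j)) < snd r"
      using step(1) 0 i0 unfolding vertically_between_def
      by (cases "x ! ((d + j) div 2)") (simp; meson less_asym less_trans)+
    then show ?thesis using step(3)[of i] i0 i True by (cases "i = j") (auto split: if_splits)
  qed
qed

definition model :: "nat \<Rightarrow> real \<times> real" where
  "model i = (case i of 0 \<Rightarrow> (-1, 0) | Suc i \<Rightarrow> pin_point x (d + i))"

lemma model_simps [simp]: "model 0 = (-1, 0)" "model (Suc i) = pin_point x (d + i)"
  by (simp_all add: model_def)

lemma model_order:
  assumes "i \<le> j"
  shows "fst (model i) < fst (model (Suc j)) \<longleftrightarrow> \<not> (0 < i \<and> i = j \<and> even (d + j))" (is ?F)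
    and "snd (model i) < snd (model (Suc j)) \<longleftrightarrow> x ! ((d + j) div 2) \<noteq> (0 < i \<and> i = j \<and> odd (d + j))" (is ?S)
    and "fst (model i) \<noteq> fst (model (Suc j)) \<and> snd (model i) \<noteq> snd (model (Suc j))" (is ?N)
proof -
  have "?F \<and> ?S \<and> ?N"
  proof (cases i)
    case 0
    \<comment> \<open>A horizontal pin has positive index, so it is not at height 0, where the
      initial point lies.\<close>
    have "odd (d + j) \<Longrightarrow> 0 < real d + real j" by (metis odd_pos of_nat_0_less_iff of_nat_add)
    then show ?thesis using 0 by (auto simp: pin_point_def)
  next
    case (Suc i')
    then have i': "d + i' < d + j" using assms by simp
    have "fst (pin_point x (d + i')) \<noteq> fst (pin_point x (d + j))"
      "snd (pin_point x (d + i')) \<noteq> snd (pin_point x (d + j))"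
      using i' injD[OF inj_fst_pin_point, of x "d + i'" "d + j"]
        injD[OF inj_snd_pin_point, of x "d + i'" "d + j"] by auto
    then show ?thesis
      using fst_pin_point_less_iff[OF i', of x] snd_pin_point_less_iff[OF i', of x]
      by (auto simp: Suc)
  qed
  then show ?F ?S ?N by blast+
qed

lemma pin_sequence_model: "pin_sequence w model"
  unfolding pin_sequence_def
proof (intro conjI impI ballI)
  have "i = j" if "fst (model i) = fst (model j) \<or> snd (model i) = snd (model j)" for i j
  proof (rule ccontr)
    assume "i \<noteq> j"
    then obtain i' j' where "i' \<le> j'" "(i, j) = (i', Suc j') \<or> (j, i) = (i', Suc j')"
      by (metis less_Suc_eq_le linorder_neqE_nat not0_implies_Suc not_less0)
    then show False using that model_order(3)[of i' j'] by auto
  qed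
  then show "inj_on (\<lambda>i. fst (model i)) {..length w}" "inj_on (\<lambda>i. snd (model i)) {..length w}"
    by (auto intro!: inj_onI)
  assume "1 \<le> length w"
  then have "0 < length w" by linarith
  then have w0: "w ! 0 = (if even d then if x ! (d div 2) then Up else Down
     else if x ! (d div 2) then RightU else RightD)" using nth_w[of 0] by simp
  show "right_of (model 1) {model 0}" "if w ! 0 \<in> {Up, RightU} then above (model 1) {model 0} else below (model 1) {model 0}"
    using model_order[of 0 0] w0
    by (auto simp: right_of_def above_def below_def One_nat_def simp del: model_simps split: if_splits)
next
  fix i assume "i \<in> {2..length w}"
  then obtain j where j: "i = Suc j" "0 < j" "j < length w" by (cases i) auto
  define old new where "old = rect_hull (model ` {..j - 1})" and "new = rect_hull (model ` {..j})"
  have fin: "finite {..n}" "{..n} \<noteq> {}" for n :: nat by auto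
  note hull_old = rect_hull_less[OF fin, of _ model "j - 1", folded old_def]
    and hull_new = rect_hull_less[OF fin, of _ model j, folded new_def]
  have dir: "case w ! j of Up \<Rightarrow> above (model i) new | Down \<Rightarrow> below (model i) new
           | RightU \<Rightarrow> right_of (model i) new | RightD \<Rightarrow> right_of (model i) new"
  proof (cases "even (d + j)")
    case True
    show ?thesis
    proof (cases "x ! ((d + j) div 2)")
      case c: True
      have "\<forall>k\<in>{..j}. snd (model k) < snd (model i)" using model_order(2)[of _ j] True j(1) c by auto
      then have "above (model i) new" unfolding above_def using hull_new(3) by blast
      then show ?thesis using True c unfolding nth_w[OF j(3)] by simp
    next
      case c: False
      have "\<not> snd (model k) < snd (model i)" "snd (model k) \<noteq> snd (model i)" if "k \<le> j" for k
        using model_order(2,3)[of k j] True j c that by auto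
      then have "\<forall>k\<in>{..j}. snd (model i) < snd (model k)" by force
      then have "below (model i) new" unfolding below_def using hull_new(4) by blast
      then show ?thesis using True c unfolding nth_w[OF j(3)] by simp
    qed
  next
    case False
    have "\<forall>k\<in>{..j}. fst (model k) < fst (model i)" using model_order(1)[of _ j] False j(1) by auto
    then have "right_of (model i) new" unfolding right_of_def using hull_new(1) by blast
    then show ?thesis using False unfolding nth_w[OF j(3)] by simp
  qed
  have "model i \<notin> new"
    using dir by (auto simp: above_def below_def right_of_def split: pin.splits)
  moreover have "horizontally_between (model i) (model j) old \<or> vertically_between (model i) (model j) old"
  proof (cases "even (d + j)")
    case True
    have "\<forall>k\<in>{..j - 1}. fst (model k) < fst (model i)" using model_order(1)[of _ j] j by auto
    moreover have "fst (model i) < fst (model j)" using model_order(1,3)[of j j] True j by auto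
    ultimately show ?thesis unfolding horizontally_between_def using hull_old(1) by blast
  next
    case False
    show ?thesis
    proof (cases "x ! ((d + j) div 2)")
      case c: True
      have "\<forall>k\<in>{..j - 1}. snd (model k) < snd (model i)" using model_order(2)[of _ j] j c by auto
      moreover have "snd (model i) < snd (model j)" using model_order(2,3)[of j j] False j c by auto
      ultimately show ?thesis unfolding vertically_between_def using hull_old(3) by blast
    next
      case c: False
      have "\<not> snd (model k) < snd (model i)" "snd (model k) \<noteq> snd (model i)" if "k \<le> j - 1" for k
        using model_order(2,3)[of k j] j c that by auto
      then have "\<forall>k\<in>{..j - 1}. snd (model i) < snd (model k)" by force
      moreover have "snd (model j) < snd (model i)" using model_order(2,3)[of j j] False j c by auto
      ultimately show ?thesis unfolding vertically_between_def using hull_old(4) by blast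
    qed
  qed
  moreover have e: "i - 2 = j - 1" "i - 1 = j" using j by auto
  ultimately show "let old = rect_hull (model ` {..i - 2}); new = rect_hull (model ` {..i - 1}) in
          model i \<notin> new \<and>
          (horizontally_between (model i) (model (i - 1)) old \<or> vertically_between (model i) (model (i - 1)) old) \<and>
          (case w ! (i - 1) of
             Up \<Rightarrow> above (model i) new
           | Down \<Rightarrow> below (model i) new
           | RightU \<Rightarrow> right_of (model i) new
           | RightD \<Rightarrow> right_of (model i) new)"
    using dir unfolding Let_def old_def new_def e by blast
qed

lemma pin_sequence_inj:
  assumes "pin_sequence w p"
  shows "inj_on (fst \<circ> p) {1..length w}" "inj_on (snd \<circ> p) {1..length w}"
  using assms unfolding pin_sequence_def comp_def by (auto elim: inj_on_subset)

lemma pin_sequence_same_order: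
  assumes "pin_sequence w p" "pin_sequence w p'"
  shows "same_order {1..length w} p p'"
proof (rule same_orderI)
  fix i j assume ij: "i \<in> {1..length w}" "j \<in> {1..length w}" "i < j"
  then obtain j' where j': "j = Suc j'" by (cases j) auto
  with ij have "j' < length w" "0 < i" "i \<le> j'" by auto
  with assms show "fst (p i) < fst (p j) \<longleftrightarrow> fst (p' i) < fst (p' j)"
    "snd (p i) < snd (p j) \<longleftrightarrow> snd (p' i) < snd (p' j)"
    unfolding j' by (simp_all add: pin_sequence_order)
qed (use pin_sequence_inj assms in auto)

text \<open>The description in \<open>psi\<close> has a unique solution: \<open>model\<close>
  realises it, and by \<open>pin_sequence_same_order\<close> all pin sequences for \<open>w\<close>
  order their points alike. This replaces \<open>psi\<close> by explicit coordinates.\<close>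

lemma points_order_iso_psi:
  "points_order_iso (pin_point x ` {d..<d + length w}) (psi w)"
proof -
  have inj: "inj_on p {1..length w}" if "pin_sequence w p" for p
    using pin_sequence_inj(1)[OF that] by (rule inj_on_imageI2)
  let ?Q = "model ` {1..length w}"
  have "points_order_iso (p ` {1..length w}) \<pi> \<longleftrightarrow> points_order_iso ?Q \<pi>" if "pin_sequence w p" for p \<pi>
    using points_order_iso_cong[OF pin_sequence_same_order inj] that pin_sequence_model by blast
  then have psi: "psi w = (THE \<pi>. is_perm \<pi> \<and> points_order_iso ?Q \<pi>)"
    unfolding psi_def using pin_sequence_model by metis
  have "inj_on fst ?Q" "inj_on snd ?Q"
    using pin_sequence_inj[OF pin_sequence_model] by (simp_all add: inj_on_imageI)
  then obtain \<pi> where \<pi>: "is_perm \<pi>" "points_order_iso ?Q \<pi>" using points_order_iso_exists[of ?Q] by auto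
  then have "\<sigma> = \<pi>" if "is_perm \<sigma>" "points_order_iso ?Q \<sigma>" for \<sigma>
    using that points_order_iso_unique perm_eq_if_order_iso by blast
  with \<pi> have "psi w = \<pi>" unfolding psi by blast
  with \<pi> have "points_order_iso ?Q (psi w)" by simp
  moreover have "?Q = pin_point x ` {d..<d + length w}"
  proof -
    have "{1..length w} = Suc ` {..<length w}" by (simp add: image_Suc_lessThan)
    moreover have "{d..<d + length w} = (\<lambda>i. d + i) ` {..<length w}"
    proof (intro equalityI subsetI)
      fix n assume "n \<in> {d..<d + length w}"
      then show "n \<in> (\<lambda>i. d + i) ` {..<length w}" by (intro image_eqI[of _ _ "n - d"]) auto
    qed auto
    ultimately show ?thesis by (simp only: image_image model_simps)
  qed
  ultimately show ?thesis by simp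
qed

end

text \<open>Factors that separate the two pins of a letter of \<open>x\<close> are absorbed into the
  choice of \<open>A\<close>, so only whole words \<open>x\<close> have to be considered.\<close>

lemma perm_class_iff:
  "\<sigma> \<in> perm_class s \<longleftrightarrow> is_perm \<sigma> \<and>
     (\<exists>x\<in>binary_language s. \<exists>A\<subseteq>{..<2 * length x}. points_order_iso (pin_point x ` A) \<sigma>)"
proof (intro iffI conjI; (elim conjE)?)
  assume \<sigma>: "\<sigma> \<in> perm_class s"
  then show "is_perm \<sigma>" by (simp add: perm_class_def)
  obtain w where w: "w \<in> pin_language s" "contains (psi w) \<sigma>" using \<sigma> by (auto simp: perm_class_def)
  then obtain x where x: "x \<in> binary_language s" "sublist w (rho x)" by (auto simp: pin_language_def)
  then obtain d where d: "d + length w \<le> 2 * length x" "\<And>i. i < length w \<Longrightarrow> w ! i = rho x ! (d + i)"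
    unfolding sublist_iff_nth by auto
  obtain T where T: "T \<subseteq> pin_point x ` {d..<d + length w}" "points_order_iso T \<sigma>"
    using w(2) contains_iff_subset[OF points_order_iso_psi[OF d(2,1)]] by blast
  then obtain A where "A \<subseteq> {d..<d + length w}" "T = pin_point x ` A" by (meson subset_image_iff)
  with T d(1) x(1)
  show "\<exists>x\<in>binary_language s. \<exists>A\<subseteq>{..<2 * length x}. points_order_iso (pin_point x ` A) \<sigma>"
    by (intro bexI[of _ x] exI[of _ A]) auto
next
  assume \<sigma>: "is_perm \<sigma>"
    and "\<exists>x\<in>binary_language s. \<exists>A\<subseteq>{..<2 * length x}. points_order_iso (pin_point x ` A) \<sigma>"
  then obtain x A where x: "x \<in> binary_language s" and A: "A \<subseteq> {..<2 * length x}"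
    "points_order_iso (pin_point x ` A) \<sigma>" by blast
  have "points_order_iso (pin_point x ` {0..<0 + length (rho x)}) (psi (rho x))"
    by (rule points_order_iso_psi) simp_all
  from contains_iff_subset[OF this, of \<sigma>] have "contains (psi (rho x)) \<sigma>"
    using A by (auto simp: lessThan_atLeast0 intro: exI[of _ "pin_point x ` A"])
  moreover have "rho x \<in> pin_language s" using x by (auto simp: pin_language_def)
  ultimately show "\<sigma> \<in> perm_class s" using \<sigma> by (auto simp: perm_class_def)
qed

section \<open>Short permutations\<close>

lemma points_order_iso_card:
  assumes "points_order_iso S \<pi>"
  shows "card S = length \<pi>"
proof -
  obtain ps where ps: "set ps = S" "sorted_wrt (\<lambda>p q. fst p < fst q) ps" "order_iso (map snd ps) \<pi>"
    using assms by (auto simp: points_order_iso_def)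
  have "distinct ps" using ps(2) by (rule distinct_if_sorted_wrt_irrefl[rotated]) simp
  then show ?thesis using ps by (auto simp: order_iso_def dest: distinct_card)
qed

text \<open>By the comparison lemmas for \<open>pin_point\<close>, only adjacency, parity and the
  letter of the later pin of each pair matter. The letter of the first chosen pin is thus never
  inspected.\<close>

lemma points_order_iso_transfer:
  assumes iso: "points_order_iso (pin_point x ` A) \<sigma>" and mono: "strict_mono_on A \<phi>"
    and fst: "\<And>m n. m \<in> A \<Longrightarrow> n \<in> A \<Longrightarrow> m < n \<Longrightarrow>
      (\<phi> n = Suc (\<phi> m) \<and> even (\<phi> n)) = (n = Suc m \<and> even n)"
    and snd: "\<And>m n. m \<in> A \<Longrightarrow> n \<in> A \<Longrightarrow> m < n \<Longrightarrow>
      (x' ! (\<phi> n div 2) \<noteq> (\<phi> n = Suc (\<phi> m) \<and> odd (\<phi> n))) = (x ! (n div 2) \<noteq> (n = Suc m \<and> odd n))"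
  shows "points_order_iso (pin_point x' ` \<phi> ` A) \<sigma>"
proof -
  have inj: "inj_on \<phi> A" using mono by (rule strict_mono_on_imp_inj_on)
  have "same_order A (pin_point x) (pin_point x' \<circ> \<phi>)"
  proof (rule same_orderI)
    show "inj_on (fst \<circ> (pin_point x' \<circ> \<phi>)) A" "inj_on (snd \<circ> (pin_point x' \<circ> \<phi>)) A"
      using comp_inj_on[OF inj inj_on_subset[OF inj_fst_pin_point[of x']]]
        comp_inj_on[OF inj inj_on_subset[OF inj_snd_pin_point[of x']]] by (simp_all add: comp_assoc)
    show "inj_on (fst \<circ> pin_point x) A" "inj_on (snd \<circ> pin_point x) A"
      by (rule inj_on_subset[OF inj_fst_pin_point subset_UNIV],
          rule inj_on_subset[OF inj_snd_pin_point subset_UNIV])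
    fix m n assume mn: "m \<in> A" "n \<in> A" "m < n"
    then have "\<phi> m < \<phi> n" using mono by (auto simp: strict_mono_on_def)
    then show "fst (pin_point x m) < fst (pin_point x n) \<longleftrightarrow>
        fst ((pin_point x' \<circ> \<phi>) m) < fst ((pin_point x' \<circ> \<phi>) n)"
      "snd (pin_point x m) < snd (pin_point x n) \<longleftrightarrow>
        snd ((pin_point x' \<circ> \<phi>) m) < snd ((pin_point x' \<circ> \<phi>) n)"
      using fst[OF mn] snd[OF mn] mn(3)
      by (simp_all only: comp_def fst_pin_point_less_iff snd_pin_point_less_iff)
  qed
  moreover have "inj_on (pin_point x) A" by (rule inj_on_subset[OF inj_pin_point subset_UNIV])
  ultimately have "points_order_iso ((pin_point x' \<circ> \<phi>) ` A) \<sigma>" using points_order_iso_cong iso by blast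
  then show ?thesis by (simp add: image_comp)
qed

definition factor :: "'a list \<Rightarrow> nat \<Rightarrow> nat \<Rightarrow> 'a list" where
  "factor x i j = map (nth x) [i..<j]"

lemma length_factor [simp]: "length (factor x i j) = j - i"
  by (simp add: factor_def)

lemma nth_factor: "r < j - i \<Longrightarrow> factor x i j ! r = x ! (i + r)"
  by (simp add: factor_def)

lemma sublist_factor:
  assumes "j \<le> length x"
  shows "sublist (factor x i j) x"
proof (cases "i \<le> j")
  case True
  then show ?thesis using assms unfolding sublist_iff_nth
    by (intro exI[of _ i]) (auto simp: nth_factor)
qed (simp add: factor_def)

text \<open>Two chosen pins interact other than through the direction of the later one only if they are adjacent.
  So the maximal runs of chosen pins may be moved apart freely, and it suffices to find
  each of them separately in the language.\<close>

definition run_embedding :: "bool list \<Rightarrow> nat set \<Rightarrow> bool list \<Rightarrow> (nat \<Rightarrow> nat) \<Rightarrow> bool" where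
  "run_embedding x B x' \<phi> \<longleftrightarrow> strict_mono_on B \<phi> \<and> \<phi> ` B \<subseteq> {..<2 * length x'} \<and>
     (\<forall>n\<in>B. even (\<phi> n) = even n \<and> x' ! (\<phi> n div 2) = x ! (n div 2)) \<and>
     (\<forall>m\<in>B. \<forall>n\<in>B. m < n \<longrightarrow> (\<phi> n = Suc (\<phi> m)) = (n = Suc m))"

text \<open>The last maximal run is split off, and its letters are glued behind the word that the
  induction gives for the remaining pins.\<close>

lemma embed_runs:
  assumes s: "\<forall>k. 0 < s k"
  shows "finite B \<Longrightarrow> B \<subseteq> {..<2 * length x} \<Longrightarrow>
    (\<And>a b. a \<le> b \<Longrightarrow> {a..b} \<subseteq> B \<Longrightarrow> factor x (a div 2) (Suc (b div 2)) \<in> binary_language s) \<Longrightarrow>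
    \<exists>x'\<in>binary_language s. \<exists>\<phi>. run_embedding x B x' \<phi>"
proof (induction "card B" arbitrary: B rule: less_induct)
  case (less B)
  show ?case
  proof (cases "B = {}")
    case True
    then have "run_embedding x B (alpha s 0) id" by (simp add: run_embedding_def strict_mono_on_def)
    then show ?thesis using alpha_in_language[of s 0] by blast
  next
    case False
    define b where "b = Max B"
    have b: "b \<in> B" "\<And>n. n \<in> B \<Longrightarrow> n \<le> b" using False less.prems(1) by (auto simp: b_def)
    define a where "a = (LEAST a. {a..b} \<subseteq> B)"
    have "{b..b} \<subseteq> B" using b by simp
    then have a: "{a..b} \<subseteq> B" "a \<le> b" unfolding a_def by (rule LeastI, rule Least_le)
    have gap: "Suc n < a" if "n \<in> B" "n < a" for n
    proof (rule ccontr)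
      assume "\<not> Suc n < a"
      then have "a = Suc n" using that by simp
      have "{n..b} \<subseteq> insert n {Suc n..b}" by auto
      then have "{n..b} \<subseteq> B" using that(1) a(1) \<open>a = Suc n\<close> by blast
      then have "a \<le> n" unfolding a_def by (rule Least_le)
      with that show False by simp
    qed
    define B0 where "B0 = {n \<in> B. n < a}"
    have B: "B = B0 \<union> {a..b}" using a b by (auto simp: B0_def)
    have "card B0 < card B" using a b less.prems(1)
      by (intro psubset_card_mono) (auto simp: B0_def)
    moreover have "finite B0" "B0 \<subseteq> {..<2 * length x}" using less.prems by (auto simp: B0_def)
    moreover have "factor x (a div 2) (Suc (b div 2)) \<in> binary_language s"
      if "a \<le> b" "{a..b} \<subseteq> B0" for a b
      using that less.prems(3)[of a b] by (auto simp: B0_def)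
    ultimately have "\<exists>x'\<in>binary_language s. \<exists>\<phi>. run_embedding x B0 x' \<phi>"
      by (rule less.hyps)
    then obtain x0 \<phi>0 where x0: "x0 \<in> binary_language s" and emb: "run_embedding x B0 x0 \<phi>0"
      by blast
    have mono: "strict_mono_on B0 \<phi>0" and range: "\<phi>0 ` B0 \<subseteq> {..<2 * length x0}"
      using emb by (simp_all add: run_embedding_def)
    have col: "even (\<phi>0 n) = even n \<and> x0 ! (\<phi>0 n div 2) = x ! (n div 2)" if "n \<in> B0" for n
      using emb that unfolding run_embedding_def by blast
    have adj: "(\<phi>0 n = Suc (\<phi>0 m)) = (n = Suc m)" if "m \<in> B0" "n \<in> B0" "m < n" for m n
      using emb that unfolding run_embedding_def by blast
    define k z where "k = a div 2" and "z = factor x k (Suc (b div 2))"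
    have "z \<in> binary_language s" unfolding z_def k_def using less.prems(3) a by blast
    then obtain g where g: "g \<noteq> []" "x0 @ g @ z \<in> binary_language s"
      using binary_language_glue[OF s x0] by blast
    define l where "l = length x0 + length g"
    \<comment> \<open>The run moves from letter \<open>k\<close> of \<open>x\<close> to letter
      \<open>l\<close>, where \<open>z\<close> starts. Whole letters move, so parity is
      kept.\<close>
    define \<phi> where "\<phi> n = (if n < a then \<phi>0 n else 2 * l + (n - 2 * k))" for n
    have k: "2 * k \<le> a" by (simp add: k_def)
    have \<phi>_low: "\<phi> n = \<phi>0 n" "\<phi> n < 2 * length x0" if "n \<in> B0" for n
      using that range by (auto simp: B0_def \<phi>_def)
    \<comment> \<open>The nonempty gap leaves at least two free pins before the run, so no adjacency
      with earlier pins arises.\<close>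
    have "Suc (length x0) \<le> l" using g(1) by (cases g) (simp_all add: l_def)
    then have \<phi>_high: "\<phi> n = 2 * l + (n - 2 * k)" "2 * length x0 + 2 \<le> \<phi> n" if "n \<in> {a..b}" for n
      using that by (simp_all add: \<phi>_def)
    have sep: "\<phi> m < \<phi> n \<and> \<phi> n \<noteq> Suc (\<phi> m) \<and> n \<noteq> Suc m" if "m \<in> B0" "n \<in> {a..b}" for m n
    proof -
      have "Suc m < a" "a \<le> n" using gap[of m] that by (simp_all add: B0_def)
      then show ?thesis using \<phi>_low(2)[OF that(1)] \<phi>_high(2)[OF that(2)] by linarith
    qed
    have mn: "\<phi> m < \<phi> n \<and> (\<phi> n = Suc (\<phi> m)) = (n = Suc m)" if "m \<in> B" "n \<in> B" "m < n" for m n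
    proof -
      have "m \<in> B0 \<or> m \<in> {a..b}" "n \<in> B0 \<or> n \<in> {a..b}" using that(1,2) B by blast+
      moreover have "\<not> (m \<in> {a..b} \<and> n \<in> B0)" using that(3) by (auto simp: B0_def)
      ultimately consider "m \<in> B0" "n \<in> B0" | "m \<in> B0" "n \<in> {a..b}" | "m \<in> {a..b}" "n \<in> {a..b}"
        by blast
      then show ?thesis
      proof cases
        case 1
        then show ?thesis using mono adj that \<phi>_low(1) by (auto simp: strict_mono_on_def)
      next
        case 2
        then show ?thesis using sep by blast
      next
        case 3
        then show ?thesis using that k \<phi>_high(1)[of m] \<phi>_high(1)[of n] by auto
      qed
    qed
    have "even (\<phi> n) = even n \<and> (x0 @ g @ z) ! (\<phi> n div 2) = x ! (n div 2) \<and>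
        \<phi> n < 2 * length (x0 @ g @ z)" if "n \<in> B" for n
    proof (cases "n \<in> B0")
      case True
      then have "\<phi>0 n div 2 < length x0" using \<phi>_low[OF True] by auto
      then show ?thesis using col[OF True] \<phi>_low[OF True] by (simp add: nth_append)
    next
      case False
      then have n: "n \<in> {a..b}" using that B by blast
      obtain r where r: "n = 2 * k + r" using n k le_trans le_Suc_ex by (metis atLeastAtMost_iff)
      have \<phi>n: "\<phi> n div 2 = l + (n div 2 - k)" using \<phi>_high(1)[OF n] by (simp add: r)
      have nd: "k \<le> n div 2" "n div 2 \<le> b div 2"
        using n by (auto simp: k_def intro: div_le_mono)
      have "even (\<phi> n) = even n" using \<phi>_high(1)[OF n] n k by simp
      moreover have "(x0 @ g @ z) ! (l + (n div 2 - k)) = z ! (n div 2 - k)"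
        by (simp add: l_def nth_append)
      moreover have "z ! (n div 2 - k) = x ! (n div 2)"
        unfolding z_def using nd by (subst nth_factor) auto
      moreover have "\<phi> n < 2 * length (x0 @ g @ z)"
      proof -
        have "\<phi> n div 2 < length (x0 @ g @ z)" unfolding \<phi>n using nd by (simp add: l_def z_def)
        then show ?thesis by simp
      qed
      ultimately show ?thesis by (simp only: \<phi>n)
    qed
    then have "run_embedding x B (x0 @ g @ z) \<phi>"
      unfolding run_embedding_def strict_mono_on_def using mn by blast
    then show ?thesis using g(2) by blast
  qed
qed

text \<open>If a chosen run of at most \<open>2m\<close> pins meets more than \<open>m\<close> letters, then it has exactly \<open>2m\<close> elements and
  starts with a horizontal pin. Since the permutation does not depend on the
  direction of its first pin, the first letter may then be changed.\<close>

lemma short_permutation_transfer: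
  assumes s: "\<forall>k. 0 < s k" and "0 < m"
    and short: "\<And>z. z \<in> binary_language t \<Longrightarrow> length z \<le> m \<Longrightarrow> z \<in> binary_language s"
    and \<sigma>: "\<sigma> \<in> perm_class t" "length \<sigma> \<le> 2 * m"
  shows "\<sigma> \<in> perm_class s"
proof -
  obtain x A where perm: "is_perm \<sigma>" and x: "x \<in> binary_language t" and A: "A \<subseteq> {..<2 * length x}"
    and iso: "points_order_iso (pin_point x ` A) \<sigma>"
    using \<sigma>(1) unfolding perm_class_iff by blast
  have fin: "finite A" using A finite_subset by blast
  have "card (pin_point x ` A) = card A"
    by (rule card_image) (rule inj_on_subset[OF inj_pin_point subset_UNIV])
  then have card: "card A \<le> 2 * m" using points_order_iso_card[OF iso] \<sigma>(2) by simp
  have "\<exists>x'\<in>binary_language s. \<exists>A'\<subseteq>{..<2 * length x'}. points_order_iso (pin_point x' ` A') \<sigma>"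
  proof (cases "\<exists>a. odd a \<and> {a..<a + 2 * m} \<subseteq> A")
    case True
    then obtain a where a: "odd a" "{a..<a + 2 * m} \<subseteq> A" by blast
    then have A_eq: "A = {a..<a + 2 * m}"
      using card card_mono[OF fin a(2)] by (intro card_subset_eq[OF fin, symmetric]) auto
    obtain k where k: "a = Suc (2 * k)" using a(1) oddE by (metis Suc_eq_plus1)
    define z where "z = factor x (Suc k) (Suc (k + m))"
    have "a + (2 * m - 1) \<in> A" using A_eq \<open>0 < m\<close> by simp
    then have "a + (2 * m - 1) < 2 * length x" using A by blast
    then have "Suc (k + m) \<le> length x" using \<open>0 < m\<close> by (simp add: k)
    then have "z \<in> binary_language t"
      unfolding z_def using sublist_factor binary_language_sublist x by blast
    then have "z \<in> binary_language s" using short by (simp add: z_def)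
    \<comment> \<open>\<open>c\<close> may differ from \<open>x ! k\<close>: of the chosen pins only
      the first, \<open>a\<close>, carries this letter, and it is never the later one of a
      pair.\<close>
    then obtain c where c: "c # z \<in> binary_language s" using binary_language_left_extend[OF s] by blast
    define \<phi> where "\<phi> n = n - 2 * k" for n :: nat
    have \<phi>: "(c # z) ! (\<phi> n div 2) = x ! (n div 2)" if "n \<in> A" "a < n" for n
    proof -
      have n: "Suc k \<le> n div 2" "n div 2 < Suc (k + m)" using that by (auto simp: A_eq k)
      then have "\<phi> n div 2 = Suc (n div 2 - Suc k)" by (simp add: \<phi>_def)
      then show ?thesis using n by (simp add: z_def nth_factor)
    qed
    have par: "even (\<phi> n) = even n" "2 * k \<le> n" if "n \<in> A" for n
      using that by (auto simp: \<phi>_def A_eq k)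
    have adj: "(\<phi> n = Suc (\<phi> m)) = (n = Suc m)" if "m \<in> A" "n \<in> A" for m n
      using par(2)[OF that(1)] par(2)[OF that(2)] by (auto simp: \<phi>_def)
    have "points_order_iso (pin_point (c # z) ` \<phi> ` A) \<sigma>"
    proof (rule points_order_iso_transfer[OF iso])
      show "strict_mono_on A \<phi>"
        using par(2) by (auto simp: strict_mono_on_def \<phi>_def diff_less_mono)
      fix m n assume "m \<in> A" "n \<in> A" "m < n"
      then show "(\<phi> n = Suc (\<phi> m) \<and> even (\<phi> n)) = (n = Suc m \<and> even n)"
        "((c # z) ! (\<phi> n div 2) \<noteq> (\<phi> n = Suc (\<phi> m) \<and> odd (\<phi> n))) = (x ! (n div 2) \<noteq> (n = Suc m \<and> odd n))"
        using par(1) adj \<phi>[of n] by (auto simp: A_eq)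
    qed
    moreover have "\<phi> ` A \<subseteq> {..<2 * length (c # z)}"
      by (auto simp: \<phi>_def A_eq z_def k)
    ultimately show ?thesis using c by blast
  next
    case False
    have "factor x (a div 2) (Suc (b div 2)) \<in> binary_language s" if ab: "a \<le> b" "{a..b} \<subseteq> A" for a b
    proof -
      have "b < 2 * length x" using ab A by auto
      then have "factor x (a div 2) (Suc (b div 2)) \<in> binary_language t"
        by (intro binary_language_sublist[OF x] sublist_factor) auto
      \<comment> \<open>A run meeting more than \<open>m\<close> letters contains
        \<open>2 * m\<close> consecutive pins from an odd start, which this case excludes, or at
        least \<open>2 * m + 1\<close> pins, more than \<open>A\<close> has.\<close>
      moreover have "Suc (b div 2) - a div 2 \<le> m"
      proof (rule ccontr)
        assume "\<not> Suc (b div 2) - a div 2 \<le> m"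
        then have *: "a div 2 + m \<le> b div 2" by simp
        show False
        proof (cases "odd a")
          case True
          then have "a + 2 * m \<le> Suc b" using * by presburger
          then have "{a..<a + 2 * m} \<subseteq> {a..b}" by auto
          then show False using False True ab by blast
        next
          case even: False
          then have "a + 2 * m \<le> b" using * by presburger
          then have "Suc (2 * m) \<le> card {a..b}" by simp
          also have "\<dots> \<le> card A" using ab fin card_mono by blast
          finally show False using card by simp
        qed
      qed
      ultimately show ?thesis using short by simp
    qed
    from embed_runs[OF s fin A this] obtain x' \<phi> where x': "x' \<in> binary_language s"
      and emb: "run_embedding x A x' \<phi>" by blast
    have "points_order_iso (pin_point x' ` \<phi> ` A) \<sigma>"
    proof (rule points_order_iso_transfer[OF iso])
      show "strict_mono_on A \<phi>" using emb by (simp add: run_embedding_def)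
      fix m n assume mn: "m \<in> A" "n \<in> A" "m < n"
      then have "even (\<phi> n) = even n" "x' ! (\<phi> n div 2) = x ! (n div 2)"
        "(\<phi> n = Suc (\<phi> m)) = (n = Suc m)"
        using emb unfolding run_embedding_def by blast+
      then show "(\<phi> n = Suc (\<phi> m) \<and> even (\<phi> n)) = (n = Suc m \<and> even n)"
        "(x' ! (\<phi> n div 2) \<noteq> (\<phi> n = Suc (\<phi> m) \<and> odd (\<phi> n))) = (x ! (n div 2) \<noteq> (n = Suc m \<and> odd n))"
        by simp_all
    qed
    moreover have "\<phi> ` A \<subseteq> {..<2 * length x'}" using emb by (simp add: run_embedding_def)
    ultimately show ?thesis using x' by blast
  qed
  then show ?thesis using perm unfolding perm_class_iff by blast
qed

section \<open>Recovering a word from a permutation\<close>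

text \<open>The first two of the chosen pins form an interval of the permutation, placed before a run which starts with a
  horizontal pin of the first letter of \<open>y\<close> and ends with the vertical pin of its last letter. In
  any other embedding, the last pin has to be the last pin of the run, and then by
  downward induction each preceding pin of the run is adjacent to the next one.\<close>

definition probe :: "nat \<Rightarrow> nat set" where
  "probe m = {0, 1} \<union> {5..2 * m + 2}"

lemma card_probe: "2 \<le> m \<Longrightarrow> card (probe m) = 2 * m"
  unfolding probe_def by (subst card_Un_disjoint) auto

lemma factor_recovered:
  assumes m: "3 \<le> m" "length y = m" and x: "x = c # c' # y"
    and iso: "points_order_iso (pin_point x ` probe m) \<sigma>"
    and iso': "points_order_iso (pin_point x' ` B) \<sigma>" and B: "B \<subseteq> {..<2 * length x'}"
  shows "sublist y x'"
proof -
  define A M where "A = probe m" and "M = 2 * m + 2"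
  \<comment> \<open>Pins 0 and 1 belong to \<open>c\<close>, and \<open>y\<close> starts at pin 4.
    Omitting 2, 3 and 4 leaves pins 0 and 1 adjacent to no pin of the run, which ends at
    \<open>M\<close>, the vertical pin of the last letter of \<open>y\<close>.\<close>
  have A: "A = {0, 1} \<union> {5..M}" by (simp add: A_def M_def probe_def)
  have M: "8 \<le> M" "even M" using m by (auto simp: M_def)
  have inj: "inj_on (pin_point x) A" "inj_on (pin_point x') B"
    by (rule inj_on_subset[OF inj_pin_point subset_UNIV])+
  obtain \<theta> where \<theta>: "bij_betw \<theta> A B" "same_order A (pin_point x) (pin_point x' \<circ> \<theta>)"
    using points_order_iso_bij[OF iso[folded A_def] inj(1) iso' inj(2)] by blast
  have \<theta>_inj: "\<theta> i \<noteq> \<theta> j" if "i \<in> A" "j \<in> A" "i \<noteq> j" for i j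
    using \<theta>(1) that by (auto simp: bij_betw_def inj_on_def)
  note same = same_orderD[OF \<theta>(2), unfolded comp_def]
  have X: "(\<theta> j = Suc (\<theta> i) \<and> even (\<theta> j)) = (j = Suc i \<and> even j)"
    if "i \<in> A" "j \<in> A" "i < j" "\<theta> i < \<theta> j" for i j
    using same(1)[OF that(1,2)] fst_pin_point_less_iff[OF that(3), of x]
      fst_pin_point_less_iff[OF that(4), of x'] by blast
  \<comment> \<open>For a pair that \<open>\<theta>\<close> reverses, the image of \<open>i\<close>
    is the later one and still lies to the left, which is possible only for an immediate
    successor.\<close>
  have X': "\<theta> i = Suc (\<theta> j)"
    if "i \<in> A" "j \<in> A" "i < j" "\<theta> j < \<theta> i" "\<not> (j = Suc i \<and> even j)" for i j
  proof -
    have "fst (pin_point x' (\<theta> i)) < fst (pin_point x' (\<theta> j))"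
      using same(1)[OF that(1,2)] fst_pin_point_less_iff[OF that(3), of x] that(5) by blast
    then show ?thesis using fst_pin_point_less_iff[OF that(4), of x'] by auto
  qed
  have Y: "(x' ! (\<theta> j div 2) \<noteq> (\<theta> j = Suc (\<theta> i) \<and> odd (\<theta> j))) = (x ! (j div 2) \<noteq> (j = Suc i \<and> odd j))"
    if "i \<in> A" "j \<in> A" "i < j" "\<theta> i < \<theta> j" for i j
    using same(2)[OF that(1,2)] snd_pin_point_less_iff[OF that(3), of x]
      snd_pin_point_less_iff[OF that(4), of x'] by blast
  \<comment> \<open>Otherwise the image of pin \<open>Suc n\<close> would carry the opposite letter,
    and then the images of both pins 0 and 1 would have to precede it immediately. This is why two
    points are placed in front.\<close>
  have odd_step: "\<theta> (Suc n) = Suc (\<theta> n) \<and> odd (\<theta> (Suc n))"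
    if n: "5 \<le> n" "Suc n \<in> A" "n \<in> A" "odd (Suc n)"
      and max: "\<And>j. j \<in> A \<Longrightarrow> j < Suc n \<Longrightarrow> \<theta> j < \<theta> (Suc n)" for n
  proof (rule ccontr)
    assume not: "\<not> (\<theta> (Suc n) = Suc (\<theta> n) \<and> odd (\<theta> (Suc n)))"
    have A01: "0 \<in> A" "1 \<in> A" by (auto simp: A)
    have n01: "0 < Suc n" "1 < Suc n" using n by auto
    have "(x' ! (\<theta> (Suc n) div 2)) = (\<not> x ! (Suc n div 2))"
      using Y[OF n(3,2) lessI max[OF n(3) lessI]] not n(4) by blast
    then have "\<theta> (Suc n) = Suc (\<theta> 0)" "\<theta> (Suc n) = Suc (\<theta> 1)"
      using Y[OF A01(1) n(2) n01(1) max[OF A01(1) n01(1)]]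
        Y[OF A01(2) n(2) n01(2) max[OF A01(2) n01(2)]] n(1) by auto
    then show False using \<theta>_inj[of 0 1] A01 by simp
  qed
  have MA: "M \<in> A" "M - 1 \<in> A" "M - 2 \<in> A" "M - 3 \<in> A" using M by (auto simp: A)
  have last: "\<theta> j < \<theta> M" if "j \<in> A" "j < M" for j
  proof -
    have "finite B" using B finite_subset by blast
    moreover have "B \<noteq> {}" using \<theta>(1) MA(1) by (auto simp: bij_betw_def)
    ultimately have "Max B \<in> B" "\<And>n. n \<in> B \<Longrightarrow> n \<le> Max B" by auto
    then obtain l where l: "l \<in> A" "\<theta> l = Max B" using \<theta>(1) by (auto simp: bij_betw_def)
    have max: "\<theta> j < \<theta> l" if "j \<in> A" "j \<noteq> l" for j
    proof -
      have "\<theta> j \<in> B" using \<theta>(1) that by (auto simp: bij_betw_def)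
      then show ?thesis using \<open>\<And>n. n \<in> B \<Longrightarrow> n \<le> Max B\<close> l \<theta>_inj[of j l] that by (simp add: le_neq_implies_less)
    qed
    have "l \<le> M" using l(1) M by (auto simp: A)
    \<comment> \<open>\<open>l\<close> is the pin with the last image. If it were
      \<open>M - 1\<close>, then \<open>\<theta> (M - 2)\<close> would come second to last, and both
      \<open>\<theta> M\<close> and \<open>\<theta> (M - 3)\<close> would have to precede it
      immediately.\<close>
    have "l \<noteq> M - 1"
    proof
      assume "l = M - 1"
      then have l': "l = Suc (M - 2)" "odd l" "5 \<le> M - 2" using M by auto
      have max': "\<theta> j < \<theta> (Suc (M - 2))" if "j \<in> A" "j < Suc (M - 2)" for j
        using max[OF that(1)] that(2) by (simp add: l'(1))
      have adj: "\<theta> l = Suc (\<theta> (M - 2))"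
        using odd_step[OF l'(3) _ MA(3) _ max'] l l' by auto
      have lt: "\<theta> j < \<theta> (M - 2)" if "j \<in> A" "j \<noteq> l" "j \<noteq> M - 2" for j
        using max[OF that(1,2)] \<theta>_inj[OF that(1) MA(3) that(3)] adj by simp
      have ne: "M \<noteq> l" "M \<noteq> M - 2" "M - 3 \<noteq> l" "M - 3 \<noteq> M - 2" "M - 3 < M - 2" "M - 2 < M"
        "M - 2 = Suc (M - 3)" "M \<noteq> Suc (M - 2)" "M \<noteq> M - 3"
        using l' M by auto
      have ev: "even (M - 2)" using M by simp
      have "\<theta> (M - 2) = Suc (\<theta> M)"
        using X'[OF MA(3,1) ne(6) lt[OF MA(1) ne(1,2)]] ne(8) by blast
      moreover have "\<theta> (M - 2) = Suc (\<theta> (M - 3))"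
        using X[OF MA(4,3) ne(5) lt[OF MA(4) ne(3,4)]] ne(7) ev by blast
      ultimately show False using \<theta>_inj[OF MA(1,4) ne(9)] by simp
    qed
    \<comment> \<open>Both \<open>M\<close> and \<open>M - 1\<close> lie to the right of such an
      \<open>l\<close>, so both images would have to precede \<open>\<theta> l\<close>
      immediately.\<close>
    moreover have "\<not> l < M - 1"
    proof
      assume lt: "l < M - 1"
      have "\<theta> l = Suc (\<theta> M)" using lt by (intro X' l MA max) auto
      moreover have "\<theta> l = Suc (\<theta> (M - 1))" using lt M by (intro X' l MA max) auto
      moreover have "M \<noteq> M - 1" using M(1) by simp
      ultimately show False using \<theta>_inj[OF MA(1,2)] by simp
    qed
    ultimately have "l = M" using \<open>l \<le> M\<close> by linarith
    then show ?thesis using max that by simp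
  qed
  have run: "(\<forall>j\<in>A. j < i \<longrightarrow> \<theta> j < \<theta> i) \<and> even (\<theta> i) = even i \<and> \<theta> M = \<theta> i + (M - i)"
    if "5 \<le> i" "i \<le> M" for i
    using that(2)
  proof (induction i rule: inc_induct)
    case base
    have "even (\<theta> M)" using X[OF MA(2,1) _ last[OF MA(2)]] M by auto
    then show ?case using last M(2) by simp
  next
    case (step n)
    then have n: "n \<in> A" "Suc n \<in> A" "5 \<le> n" using that(1) by (auto simp: A)
    then have max: "\<theta> j < \<theta> (Suc n)" if "j \<in> A" "j < Suc n" for j using step.IH that by blast
    have adj: "\<theta> (Suc n) = Suc (\<theta> n)"
    proof (cases "even (Suc n)")
      case True
      then show ?thesis using X[OF n(1,2) lessI max[OF n(1) lessI]] by blast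
    next
      case False
      then show ?thesis using odd_step[OF n(3,2,1) _ max] by blast
    qed
    have "\<theta> j < \<theta> n" if "j \<in> A" "j < n" for j
      using max[OF that(1)] \<theta>_inj[OF that(1) n(1)] that(2) adj by simp
    then show ?case using step adj by auto
  qed
  \<comment> \<open>At most one of the pins 0 and 1 is sent to the immediate predecessor of
    \<open>\<theta> i\<close>; comparing heights with the other one reveals the letter.\<close>
  have colour: "x' ! (\<theta> i div 2) = x ! (i div 2)" if i: "5 \<le> i" "i \<le> M" for i
  proof -
    have iA: "i \<in> A" using i by (simp add: A)
    have A01: "0 \<in> A" "1 \<in> A" by (auto simp: A)
    have "\<theta> i \<noteq> Suc (\<theta> 0) \<or> \<theta> i \<noteq> Suc (\<theta> 1)" using \<theta>_inj[OF A01] by auto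
    then obtain j where "j \<in> {0, 1}" "\<theta> i \<noteq> Suc (\<theta> j)" by blast
    then have j: "j \<in> A" "j \<le> 1" "\<theta> i \<noteq> Suc (\<theta> j)" using A01 by auto
    then have "j < i" "i \<noteq> Suc j" using i by auto
    then show ?thesis using Y[OF j(1) iA] run[OF i] j by blast
  qed
  define k where "k = \<theta> 5 div 2"
  have k: "\<theta> 5 = Suc (2 * k)" using run[of 5] M by (auto simp: k_def)
  have \<theta>i: "\<theta> i = 2 * k + (i - 4)" if i: "5 \<le> i" "i \<le> M" for i
    using run[OF i] run[of 5] M k i by auto
  have "\<theta> M < 2 * length x'" using \<theta>(1) MA(1) B by (auto simp: bij_betw_def)
  then have "k + length y \<le> length x'" using \<theta>i[of M] M m by (simp add: M_def)
  moreover have "y ! r = x' ! (k + r)" if r: "r < length y" for r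
  proof -
    \<comment> \<open>The vertical pin of the first letter of \<open>y\<close> is not chosen, so
      this letter is read off its horizontal pin 5, the others off their vertical pins.\<close>
    define i where "i = (if r = 0 then 5 else 2 * r + 4)"
    have i: "5 \<le> i" "i \<le> M" "i div 2 = Suc (Suc r)" "\<theta> i div 2 = k + r"
      using r m \<theta>i[of i] by (auto simp: i_def M_def)
    show ?thesis using colour[OF i(1,2)] unfolding i(3,4) x by simp
  qed
  ultimately show ?thesis unfolding sublist_iff_nth by blast
qed

section \<open>Comparison of the classes\<close>

lemma finite_of_length: "finite (of_length (perm_class s) n)"
proof (rule finite_subset)
  show "of_length (perm_class s) n \<subseteq> permutations_of_set {1..n}"
    by (auto simp: of_length_def perm_class_def is_perm_def)
qed simp

text \<open>Turns the strict inclusion of finite unions into a difference of partial sums of the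
  enumeration sequences.\<close>

lemma card_of_length_le:
  "card (\<Union>n\<le>N. of_length (perm_class s) n) = (\<Sum>n\<le>N. enumeration (perm_class s) n)"
  unfolding enumeration_def
proof (rule card_UN_disjoint)
  show "\<forall>n\<in>{..N}. finite (of_length (perm_class s) n)" by (simp add: finite_of_length)
qed (auto simp: of_length_def)

lemma alpha_cong: "(\<And>i. i < k \<Longrightarrow> s i = t i) \<Longrightarrow> alpha s k = alpha t k"
  by (induction k) auto

theorem theorem8p1:
  fixes s t :: "nat \<Rightarrow> nat"
  assumes "\<forall>k. 0 < s k"
    and "\<forall>k. 0 < t k"
    and "s \<noteq> t"
    and "less_fun s t"
  shows "(\<exists>N::nat. (\<Union>n\<le>N. of_length (perm_class t) n) \<subset> (\<Union>n\<le>N. of_length (perm_class s) n))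
    \<and> enumeration (perm_class s) \<noteq> enumeration (perm_class t)"
proof -
  note s = assms(1) and t = assms(2)
  obtain k where k: "s k < t k" "\<And>i. i < k \<Longrightarrow> s i = t i"
    using assms(4) by (auto simp: less_fun_def)
  have alpha: "alpha t k = alpha s k" using alpha_cong[of k s t] k(2) by simp
  define y m where "y = marker s k (s k)" and "m = length y"
  have m_eq: "m = s k * length (alpha s k) + 2" by (simp add: m_def y_def length_marker)
  have "1 * 2 \<le> s k * length (alpha s k)"
    using s length_alpha_ge_2[OF s, of k] by (intro mult_le_mono) (auto simp: Suc_le_eq)
  then have m: "4 \<le> m" by (simp add: m_eq)
  have short: "z \<in> binary_language s" if "z \<in> binary_language t" "length z \<le> m" for z
    using short_factors_in_language[OF s t alpha k(1) that(1)] that(2) by (simp add: m_eq)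
  have y: "y \<in> binary_language s" unfolding y_def by (rule marker_in_language[OF s])
  have "y = marker t k (s k)" by (simp add: y_def marker_def alpha)
  then have y': "y \<notin> binary_language t" using marker_notin_language[OF t] s k(1) by simp
  \<comment> \<open>Two further letters make room for the two initial points of the probe and for
    the gap after them.\<close>
  obtain c c' where x: "c # c' # y \<in> binary_language s"
    using binary_language_left_extend[OF s] y by meson
  let ?x = "c # c' # y"
  have inj: "inj_on fst (pin_point ?x ` probe m)" "inj_on snd (pin_point ?x ` probe m)"
    "inj_on (pin_point ?x) (probe m)"
    by (rule inj_on_imageI, rule inj_on_subset[OF inj_fst_pin_point subset_UNIV],
        rule inj_on_imageI, rule inj_on_subset[OF inj_snd_pin_point subset_UNIV],
        rule inj_on_subset[OF inj_pin_point subset_UNIV])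
  have "finite (pin_point ?x ` probe m)" by (simp add: probe_def)
  then obtain \<sigma> where \<sigma>: "is_perm \<sigma>" "points_order_iso (pin_point ?x ` probe m) \<sigma>"
    using points_order_iso_exists inj(1,2) by blast
  have "probe m \<subseteq> {..<2 * length ?x}" using m by (auto simp: probe_def m_def)
  then have \<sigma>_s: "\<sigma> \<in> perm_class s" using \<sigma> x unfolding perm_class_iff by blast
  have \<sigma>_t: "\<sigma> \<notin> perm_class t"
  proof
    assume "\<sigma> \<in> perm_class t"
    then obtain x' B where x': "x' \<in> binary_language t" "B \<subseteq> {..<2 * length x'}"
      "points_order_iso (pin_point x' ` B) \<sigma>" unfolding perm_class_iff by blast
    have "sublist y x'"
      by (rule factor_recovered[OF _ _ refl \<sigma>(2) x'(3,2)]) (use m in \<open>simp_all add: m_def\<close>)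
    then show False using y' x'(1) binary_language_sublist by blast
  qed
  \<comment> \<open>This is the largest length for which \<open>short_permutation_transfer\<close>
    gives the inclusion, so \<open>N = 2 * m\<close> serves both for the inclusion and for its
    strictness.\<close>
  have "length \<sigma> = 2 * m"
    using points_order_iso_card[OF \<sigma>(2)] card_image[OF inj(3)] card_probe m by simp
  then have "\<sigma> \<in> (\<Union>n\<le>2 * m. of_length (perm_class s) n)" using \<sigma>_s by (auto simp: of_length_def)
  moreover have "\<sigma> \<notin> (\<Union>n\<le>2 * m. of_length (perm_class t) n)" using \<sigma>_t by (auto simp: of_length_def)
  moreover have "(\<Union>n\<le>2 * m. of_length (perm_class t) n) \<subseteq> (\<Union>n\<le>2 * m. of_length (perm_class s) n)"
  proof
    fix \<tau> assume "\<tau> \<in> (\<Union>n\<le>2 * m. of_length (perm_class t) n)"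
    then have "\<tau> \<in> perm_class t" "length \<tau> \<le> 2 * m" by (auto simp: of_length_def)
    then have "\<tau> \<in> perm_class s" using m by (intro short_permutation_transfer[OF s _ short]) auto
    then show "\<tau> \<in> (\<Union>n\<le>2 * m. of_length (perm_class s) n)"
      using \<open>length \<tau> \<le> 2 * m\<close> by (simp add: of_length_def)
  qed
  ultimately have sub: "(\<Union>n\<le>2 * m. of_length (perm_class t) n) \<subset> (\<Union>n\<le>2 * m. of_length (perm_class s) n)"
    by (metis psubsetI)
  have "finite (\<Union>n\<le>2 * m. of_length (perm_class s) n)" by (simp add: finite_of_length)
  from psubset_card_mono[OF this sub] have enum: "enumeration (perm_class s) \<noteq> enumeration (perm_class t)"
    by (auto simp: card_of_length_le)
  show ?thesis
  proof (intro conjI exI)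
    show "(\<Union>n\<le>2 * m. of_length (perm_class t) n) \<subset> (\<Union>n\<le>2 * m. of_length (perm_class s) n)"
      by (rule sub)
    show "enumeration (perm_class s) \<noteq> enumeration (perm_class t)" by (rule enum)
  qed
qed

end
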